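(* Let $d,d',a,t$ be positive integers. Suppose that $t\ge 2$ and that $d,d'\ge 2$ or $d,a\ge 2$. Then the dimension of the neuromanifold $\mathcal{M}_{d,d',a}$ is $$\dim(\mathcal{M}_{d,d',a})=\begin{cases}2ad+dd'-a^2-1 & \text{if } a\le d,\\ d^2+dd'-1 & \text{otherwise.}\end{cases}$$
   Context: For $Q,K\in\mathbb{R}^{a\times d}$ and $V\in\mathbb{R}^{d'\times d}$, the lightning self-attention mechanism is the map $\varphi_{(Q,K,V)}\colon\mathbb{R}^{d\times t}\to\mathbb{R}^{d'\times t}$, $X\mapsto VXX^\top K^\top QX$. The neuromanifold $\mathcal{M}_{d,d',a}$ is the set of all maps $\varphi_{(Q,K,V)}$ with $Q,K\in\mathbb{R}^{a\times d}$, $V\in\mathbb{R}^{d'\times d}$. It is a semi-algebraic subset of the finite-dimensional real vector space $\mathrm{Sym}_3(\mathbb{R}^{d\times t},\mathbb{R}^{d'\times t})$ of maps $\mathbb{R}^{d\times t}\to\mathbb{R}^{d'\times t}$ all of whose output coordinates are homogeneous polynomials of degree $3$. Dimension is meant in the sense of (semi-)algebraic geometry, i.e. the dimension of the Zariski closure. *)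

theory Defs
  imports "HOL-Analysis.Analysis"
begin

section \<open>Zariski topology and Krull dimension\<close>

text \<open>
  Throughout, \<open>W\<close> is a set of functions into a real vector space, closed under pointwise
  linear combinations (function types carry no \<open>real_vector\<close> structure in the library, hence
  the pointwise formulation).
\<close>

definition linear_functional_on :: "('x \<Rightarrow> 'v::real_vector) set \<Rightarrow> (('x \<Rightarrow> 'v) \<Rightarrow> real) \<Rightarrow> bool" where
  "linear_functional_on W L \<longleftrightarrow>
     (\<forall>f\<in>W. \<forall>g\<in>W. L (\<lambda>x. f x + g x) = L f + L g) \<and>
     (\<forall>c. \<forall>f\<in>W. L (\<lambda>x. c *\<^sub>R f x) = c * L f)"

text \<open>The real algebra generated by the linear functionals, i.e. \<open>Sym(W\<^sup>*)\<close>; for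
  finite-dimensional \<open>W\<close> these are the polynomials in the coordinates with respect to any basis.\<close>

inductive polynomial_on :: "('x \<Rightarrow> 'v::real_vector) set \<Rightarrow> (('x \<Rightarrow> 'v) \<Rightarrow> real) \<Rightarrow> bool"
  for W where
    linear: "linear_functional_on W L \<Longrightarrow> polynomial_on W L"
  | const: "polynomial_on W (\<lambda>_. c)"
  | add: "\<lbrakk>polynomial_on W p; polynomial_on W q\<rbrakk> \<Longrightarrow> polynomial_on W (\<lambda>f. p f + q f)"
  | mult: "\<lbrakk>polynomial_on W p; polynomial_on W q\<rbrakk> \<Longrightarrow> polynomial_on W (\<lambda>f. p f * q f)"

definition zero_locus ::
    "('x \<Rightarrow> 'v::real_vector) set \<Rightarrow> (('x \<Rightarrow> 'v) \<Rightarrow> real) set \<Rightarrow> ('x \<Rightarrow> 'v) set" where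
  "zero_locus W P = {f \<in> W. \<forall>p\<in>P. p f = 0}"

definition zariski_topology :: "('x \<Rightarrow> 'v::real_vector) set \<Rightarrow> ('x \<Rightarrow> 'v) topology" where
  "zariski_topology W =
     topology (\<lambda>U. \<exists>P. P \<subseteq> Collect (polynomial_on W) \<and> U = W - zero_locus W P)"

lemma istopology_zariski:
  "istopology (\<lambda>U. \<exists>P. P \<subseteq> Collect (polynomial_on W) \<and> U = W - zero_locus W P)"
  (is "istopology ?O")
proof -
  have "?O (S \<inter> T)" if ST: "?O S" "?O T" for S T
  proof -
    obtain P Q where P: "P \<subseteq> Collect (polynomial_on W)" "S = W - zero_locus W P"
      and Q: "Q \<subseteq> Collect (polynomial_on W)" "T = W - zero_locus W Q"
      using ST by blast
    let ?R = "{\<lambda>f. p f * q f | p q. p \<in> P \<and> q \<in> Q}"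
    have "?R \<subseteq> Collect (polynomial_on W)"
      using P(1) Q(1) by (auto intro!: polynomial_on.mult)
    moreover have "S \<inter> T = W - zero_locus W ?R"
      unfolding P(2) Q(2) zero_locus_def by fastforce
    ultimately show ?thesis by blast
  qed
  moreover have "?O (\<Union>\<K>)" if KK: "\<forall>K\<in>\<K>. ?O K" for \<K>
  proof -
    obtain P where P: "\<And>K. K \<in> \<K> \<Longrightarrow> P K \<subseteq> Collect (polynomial_on W)"
        "\<And>K. K \<in> \<K> \<Longrightarrow> K = W - zero_locus W (P K)"
      using KK by metis
    have "(\<Union>K\<in>\<K>. P K) \<subseteq> Collect (polynomial_on W)"
      using P(1) by blast
    moreover have "\<Union>\<K> = (\<Union>K\<in>\<K>. W - zero_locus W (P K))"
      using P(2) by auto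
    then have "\<Union>\<K> = W - zero_locus W (\<Union>K\<in>\<K>. P K)"
      unfolding zero_locus_def by auto
    ultimately show ?thesis by blast
  qed
  ultimately show ?thesis
    unfolding istopology_def by blast
qed

lemma openin_zariski:
  "openin (zariski_topology W) U \<longleftrightarrow>
     (\<exists>P. P \<subseteq> Collect (polynomial_on W) \<and> U = W - zero_locus W P)"
  unfolding zariski_topology_def topology_inverse'[OF istopology_zariski] ..

lemma topspace_zariski [simp]: "topspace (zariski_topology W) = W"
proof -
  have "openin (zariski_topology W) W"
    unfolding openin_zariski
    by (rule exI[of _ "{\<lambda>_. 1}"]) (auto simp: zero_locus_def intro: polynomial_on.const)
  then show ?thesis
    unfolding topspace_def using openin_zariski[of W] by blast
qed

lemma closedin_zariski:
  "closedin (zariski_topology W) Z \<longleftrightarrow>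
     (\<exists>P. P \<subseteq> Collect (polynomial_on W) \<and> Z = zero_locus W P)"
proof -
  have "W - Z = W - zero_locus W P \<longleftrightarrow> Z = zero_locus W P" if "Z \<subseteq> W" for P
    using that unfolding zero_locus_def by blast
  moreover have "zero_locus W P \<subseteq> W" for P
    unfolding zero_locus_def by blast
  ultimately show ?thesis
    unfolding closedin_def openin_zariski topspace_zariski by metis
qed

definition irreducible_closedin :: "'b topology \<Rightarrow> 'b set \<Rightarrow> bool" where
  "irreducible_closedin T Z \<longleftrightarrow>
     closedin T Z \<and> Z \<noteq> {} \<and>
     (\<forall>A B. closedin T A \<and> closedin T B \<and> Z = A \<union> B \<longrightarrow> Z = A \<or> Z = B)"

text \<open>Supremum of the lengths \<open>n\<close> of chains \<open>Z 0 \<subset> \<dots> \<subset> Z n\<close> of irreducible closed sets.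
  The empty space gets \<open>0\<close> here, not \<open>-\<infinity>\<close>.\<close>

definition krull_dim :: "'b topology \<Rightarrow> enat" where
  "krull_dim T =
     (SUP n \<in> {n. \<exists>Z. (\<forall>i\<le>n. irreducible_closedin T (Z i)) \<and> (\<forall>i<n. Z i \<subset> Z (Suc i))}. enat n)"

definition zariski_dim :: "('x \<Rightarrow> 'v::real_vector) set \<Rightarrow> ('x \<Rightarrow> 'v) set \<Rightarrow> enat" where
  "zariski_dim W S =
     krull_dim (subtopology (zariski_topology W) (zariski_topology W closure_of S))"


section \<open>Lightning self-attention\<close>

text \<open>\<open>real^'n^'m\<close> is the type of matrices with \<open>m\<close> rows and \<open>n\<close> columns; \<open>'e\<close> plays the role
  of \<open>d'\<close>.\<close>

definition lightning_attention ::
    "real^'d^'a \<Rightarrow> real^'d^'a \<Rightarrow> real^'d^'e \<Rightarrow> real^'t^'d \<Rightarrow> real^'t^'e" where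
  "lightning_attention Q K V =
     (\<lambda>X. V ** X ** transpose X ** transpose K ** Q ** X)"

text \<open>The inner dimension \<open>a\<close> does not occur in the type of the maps, hence the type argument.\<close>

definition neuromanifold :: "'a::finite itself \<Rightarrow> (real^'t^'d \<Rightarrow> real^'t^'e) set" where
  "neuromanifold _ = {lightning_attention Q K V | (Q :: real^'d^'a) (K :: real^'d^'a) V. True}"

definition cubic_form :: "(real^'t^'d \<Rightarrow> real) \<Rightarrow> bool" where
  "cubic_form h \<longleftrightarrow>
     (\<exists>c :: 'd \<times> 't \<Rightarrow> 'd \<times> 't \<Rightarrow> 'd \<times> 't \<Rightarrow> real. \<forall>X.
        h X = (\<Sum>p\<in>UNIV. \<Sum>q\<in>UNIV. \<Sum>r\<in>UNIV.
                 c p q r * X $ fst p $ snd p * X $ fst q $ snd q * X $ fst r $ snd r))"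

definition Sym3 :: "(real^'t^'d \<Rightarrow> real^'t^'e) set" where
  "Sym3 = {f. \<forall>i j. cubic_form (\<lambda>X. f X $ i $ j)}"

lemma cubic_form_monomial:
  fixes h :: "real^'t^'d \<Rightarrow> real"
  assumes "\<And>X. h X = c * X $ fst p $ snd p * X $ fst q $ snd q * X $ fst r $ snd r"
  shows "cubic_form h"
  unfolding cubic_form_def
proof (intro exI allI)
  fix X :: "real^'t^'d"
  define x where "x p' = X $ fst p' $ snd p'" for p'
  let ?c = "\<lambda>p' q' r'. if p' = p \<and> q' = q \<and> r' = r then c else 0"
  have if_mult: "(if P then u else 0) * v = (if P then u * v else 0)" for P and u v :: real
    by simp
  have r_sum: "(\<Sum>r'\<in>UNIV. ?c p' q' r' * x p' * x q' * x r')
      = (if q' = q then if p' = p then c * x p * x q * x r else 0 else 0)" for p' q'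
    by (simp add: if_mult)
  have "(\<Sum>p'\<in>UNIV. \<Sum>q'\<in>UNIV. \<Sum>r'\<in>UNIV. ?c p' q' r' * x p' * x q' * x r') = h X"
    unfolding r_sum by (simp add: assms x_def)
  then show "h X = (\<Sum>p'\<in>UNIV. \<Sum>q'\<in>UNIV. \<Sum>r'\<in>UNIV. ?c p' q' r' *
      X $ fst p' $ snd p' * X $ fst q' $ snd q' * X $ fst r' $ snd r')"
    unfolding x_def ..
qed

lemma cubic_form_sum:
  assumes "finite I" "\<And>i. i \<in> I \<Longrightarrow> cubic_form (h i)"
  shows "cubic_form (\<lambda>X. \<Sum>i\<in>I. h i X)"
  using assms
proof (induction I rule: finite_induct)
  case empty
  then show ?case
    by (auto simp: cubic_form_def intro!: exI[of _ "\<lambda>_ _ _. 0"])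
next
  case (insert i I)
  obtain c where c: "\<And>X. h i X = (\<Sum>p\<in>UNIV. \<Sum>q\<in>UNIV. \<Sum>r\<in>UNIV.
        c p q r * X $ fst p $ snd p * X $ fst q $ snd q * X $ fst r $ snd r)"
    using insert.prems unfolding cubic_form_def by blast
  obtain c' where c': "\<And>X. (\<Sum>i\<in>I. h i X) = (\<Sum>p\<in>UNIV. \<Sum>q\<in>UNIV. \<Sum>r\<in>UNIV.
        c' p q r * X $ fst p $ snd p * X $ fst q $ snd q * X $ fst r $ snd r)"
    using insert unfolding cubic_form_def by blast
  show ?case
    unfolding cubic_form_def using insert.hyps
    by (intro exI[of _ "\<lambda>p q r. c p q r + c' p q r"] allI)
       (simp add: c c' distrib_right sum.distrib)
qed

lemma neuromanifold_subset_Sym3: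
  "(neuromanifold TYPE('a::finite) :: (real^'t^'d \<Rightarrow> real^'t^'e) set) \<subseteq> Sym3"
proof -
  have "cubic_form (\<lambda>X :: real^'t^'d. lightning_attention Q K V X $ i $ j)"
    for Q K :: "real^'d^'a" and V :: "real^'d^'e" and i j
  proof -
    have *: "lightning_attention Q K V X $ i $ j =
      (\<Sum>k\<in>UNIV. \<Sum>l\<in>UNIV. \<Sum>m\<in>UNIV. \<Sum>n\<in>UNIV. \<Sum>s\<in>UNIV.
        V $ i $ s * X $ s $ n * X $ m $ n * K $ l $ m * Q $ l $ k * X $ k $ j)" for X :: "real^'t^'d"
      unfolding lightning_attention_def matrix_matrix_mult_def transpose_def
      by (simp add: sum_distrib_right)
    have "cubic_form (\<lambda>X :: real^'t^'d.
        V $ i $ s * X $ s $ n * X $ m $ n * K $ l $ m * Q $ l $ k * X $ k $ j)" for k l m n s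
      by (rule cubic_form_monomial[where c = "V $ i $ s * K $ l $ m * Q $ l $ k"
            and p = "(s, n)" and q = "(m, n)" and r = "(k, j)"]) simp
    then show ?thesis
      unfolding * by (intro cubic_form_sum finite)
  qed
  then show ?thesis
    unfolding neuromanifold_def Sym3_def by blast
qed

end

theory Submission
  imports Defs "HOL-Computational_Algebra.Polynomial"
begin

text \<open>The neuromanifold contains a Zariski dense subset which is the image of a polynomial map
  \<open>\<Psi>\<close> in as many parameters as the claimed dimension. For a chain \<open>Z\<^sub>0 \<subset> \<dots> \<subset> Z\<^sub>n\<close> of irreducible
  closed subsets, polynomials vanishing on \<open>Z\<^sub>i\<close> but not on \<open>Z\<^sub>i\<^sub>+\<^sub>1\<close> are algebraically independent
  on \<open>Z\<^sub>n\<close>; pulling them back along \<open>\<Psi>\<close> and counting monomials of bounded degree shows that \<open>n\<close>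
  is at most the number of parameters. Conversely, the closures of the images of a flag of
  coordinate subspaces are irreducible, as one sees by restricting polynomials to lines, and
  for a suitable base point and order of the coordinates explicit coefficients of the cubic map
  separate consecutive members of the flag.\<close>

section \<open>Polynomial functions in finitely many parameters\<close>

text \<open>For \<open>a \<le> d\<close> the count is that of pairs \<open>(A, V)\<close> where
  \<open>A = K^T Q\<close> has rank at most \<open>a\<close>: such matrices have dimension
  \<open>d^2 - (d - a)^2 = 2ad - a^2\<close>, the matrices \<open>V\<close> add \<open>dd'\<close>,
  and replacing \<open>(A, V)\<close> by \<open>(c A, V / c)\<close> costs 1. For
  \<open>a > d\<close> every square \<open>A\<close> occurs. Both bounds count parameters, so the
  parametrization must be free of redundancy; this forces a choice of rows spanning \<open>A\<close>
  and of a normalised entry of \<open>V\<close>, and such choices work only generically. All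
  genericity rests on one fact: a real polynomial on a line that is nonzero at one point has
  finitely many zeros. It yields irreducibility, density and the spanning rows from real points
  alone. For the lower bound, the coordinates are freed in an order in which each parameter can be
  detected in the map while those of larger rank still sit at the base point.\<close>

definition poly_fun :: "'i set \<Rightarrow> nat \<Rightarrow> (('i \<Rightarrow> real) \<Rightarrow> real) \<Rightarrow> bool" where
  "poly_fun I n f \<longleftrightarrow>
     (\<exists>c. f = (\<lambda>\<theta>. \<Sum>\<beta>\<in>I \<rightarrow>\<^sub>E {..n}. c \<beta> * (\<Prod>i\<in>I. \<theta> i ^ \<beta> i)))"

lemma poly_funE:
  assumes "poly_fun I n f"
  obtains c where "f = (\<lambda>\<theta>. \<Sum>\<beta>\<in>I \<rightarrow>\<^sub>E {..n}. c \<beta> * (\<Prod>i\<in>I. \<theta> i ^ \<beta> i))"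
  using assms unfolding poly_fun_def by blast

context
  fixes I :: "'i set"
  assumes fin: "finite I"
begin

lemma poly_fun_monomial:
  assumes "\<And>i. i \<in> I \<Longrightarrow> \<beta> i \<le> n"
  shows "poly_fun I n (\<lambda>\<theta>. c * (\<Prod>i\<in>I. \<theta> i ^ \<beta> i))"
  unfolding poly_fun_def
proof (intro exI ext)
  fix \<theta> :: "'i \<Rightarrow> real"
  let ?B = "I \<rightarrow>\<^sub>E {..n}"
  have mem: "restrict \<beta> I \<in> ?B"
    using assms by auto
  have "(\<Sum>\<gamma>\<in>?B. (if \<gamma> = restrict \<beta> I then c else 0) * (\<Prod>i\<in>I. \<theta> i ^ \<gamma> i))
      = (\<Sum>\<gamma>\<in>?B. if \<gamma> = restrict \<beta> I then c * (\<Prod>i\<in>I. \<theta> i ^ \<gamma> i) else 0)"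
    by (intro sum.cong) auto
  also have "\<dots> = c * (\<Prod>i\<in>I. \<theta> i ^ restrict \<beta> I i)"
    using mem fin by (simp add: finite_PiE)
  also have "\<dots> = c * (\<Prod>i\<in>I. \<theta> i ^ \<beta> i)"
    by simp
  finally show "c * (\<Prod>i\<in>I. \<theta> i ^ \<beta> i)
      = (\<Sum>\<gamma>\<in>?B. (if \<gamma> = restrict \<beta> I then c else 0) * (\<Prod>i\<in>I. \<theta> i ^ \<gamma> i))" ..
qed

lemma poly_fun_const: "poly_fun I n (\<lambda>_. c)"
  using poly_fun_monomial[of "\<lambda>_. 0" n c] by simp

lemma poly_fun_var:
  assumes "i \<in> I"
  shows "poly_fun I 1 (\<lambda>\<theta>. \<theta> i)"
proof -
  have "(\<Prod>j\<in>I. \<theta> j ^ (if j = i then 1 else 0)) = \<theta> i" for \<theta> :: "'i \<Rightarrow> real"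
  proof -
    have "(\<Prod>j\<in>I. \<theta> j ^ (if j = i then 1 else 0)) = (\<Prod>j\<in>I. if j = i then \<theta> j else 1)"
      by (intro prod.cong) auto
    then show ?thesis
      using assms fin by simp
  qed
  then show ?thesis
    using poly_fun_monomial[of "\<lambda>j. if j = i then 1 else 0" 1 1] by simp
qed

lemma poly_fun_add:
  assumes "poly_fun I n f" "poly_fun I n g"
  shows "poly_fun I n (\<lambda>\<theta>. f \<theta> + g \<theta>)"
proof -
  obtain c where c: "f = (\<lambda>\<theta>. \<Sum>\<beta>\<in>I \<rightarrow>\<^sub>E {..n}. c \<beta> * (\<Prod>i\<in>I. \<theta> i ^ \<beta> i))"
    using assms(1) by (rule poly_funE)
  obtain d where d: "g = (\<lambda>\<theta>. \<Sum>\<beta>\<in>I \<rightarrow>\<^sub>E {..n}. d \<beta> * (\<Prod>i\<in>I. \<theta> i ^ \<beta> i))"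
    using assms(2) by (rule poly_funE)
  show ?thesis
    unfolding poly_fun_def c d
    by (intro exI[of _ "\<lambda>\<beta>. c \<beta> + d \<beta>"]) (simp add: distrib_right sum.distrib)
qed

lemma poly_fun_sum:
  assumes "finite K" "\<And>k. k \<in> K \<Longrightarrow> poly_fun I n (f k)"
  shows "poly_fun I n (\<lambda>\<theta>. \<Sum>k\<in>K. f k \<theta>)"
  using assms by (induction K rule: finite_induct) (auto intro: poly_fun_const poly_fun_add)

lemma poly_fun_mult:
  assumes "poly_fun I m f" "poly_fun I n g"
  shows "poly_fun I (m + n) (\<lambda>\<theta>. f \<theta> * g \<theta>)"
proof -
  obtain c where c: "f = (\<lambda>\<theta>. \<Sum>\<beta>\<in>I \<rightarrow>\<^sub>E {..m}. c \<beta> * (\<Prod>i\<in>I. \<theta> i ^ \<beta> i))"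
    using assms(1) by (rule poly_funE)
  obtain d where d: "g = (\<lambda>\<theta>. \<Sum>\<beta>\<in>I \<rightarrow>\<^sub>E {..n}. d \<beta> * (\<Prod>i\<in>I. \<theta> i ^ \<beta> i))"
    using assms(2) by (rule poly_funE)
  have eq: "f \<theta> * g \<theta> = (\<Sum>\<beta>\<in>I \<rightarrow>\<^sub>E {..m}. \<Sum>\<gamma>\<in>I \<rightarrow>\<^sub>E {..n}.
      (c \<beta> * d \<gamma>) * (\<Prod>i\<in>I. \<theta> i ^ (\<beta> i + \<gamma> i)))" for \<theta>
    unfolding c d by (simp add: sum_product power_add prod.distrib mult_ac)
  show ?thesis
    unfolding eq
    by (intro poly_fun_sum poly_fun_monomial finite_PiE fin finite_atMost add_mono) auto
qed

lemma poly_fun_mono: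
  assumes "poly_fun I m f" "m \<le> n"
  shows "poly_fun I n f"
  \<comment> \<open>The constant 1, taken with bound \<open>n - m\<close>, serves as a factor that
    raises the bound.\<close>
  using poly_fun_mult[OF assms(1) poly_fun_const[of "n - m" 1]] assms(2) by simp

lemma poly_fun_power:
  assumes "poly_fun I n f"
  shows "poly_fun I (n * k) (\<lambda>\<theta>. f \<theta> ^ k)"
proof (induction k)
  case 0
  then show ?case
    by (simp add: poly_fun_const)
next
  case (Suc k)
  then show ?case
    using poly_fun_mult[OF assms Suc] by (simp add: add.commute)
qed

lemma poly_fun_prod:
  assumes "finite K" "\<And>k. k \<in> K \<Longrightarrow> poly_fun I n (f k)"
  shows "poly_fun I (card K * n) (\<lambda>\<theta>. \<Prod>k\<in>K. f k \<theta>)"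
  using assms
proof (induction K rule: finite_induct)
  case empty
  then show ?case
    by (simp add: poly_fun_const)
next
  case (insert k K)
  then show ?case
    using poly_fun_mult[of n "f k" "card K * n" "\<lambda>\<theta>. \<Prod>k\<in>K. f k \<theta>"] by simp
qed

end

section \<open>Restrictions to lines: polynomials in one variable\<close>

definition univariate_poly :: "(real \<Rightarrow> real) \<Rightarrow> bool" where
  "univariate_poly h \<longleftrightarrow> (\<exists>p. h = poly p)"

lemma univariate_poly_affine: "univariate_poly (\<lambda>s. a + s * b)"
  unfolding univariate_poly_def by (intro exI[of _ "[:a, b:]"]) auto

lemma univariate_poly_const: "univariate_poly (\<lambda>_. a)"
  using univariate_poly_affine[of a 0] by simp

lemma univariate_poly_add:
  assumes "univariate_poly f" "univariate_poly g"
  shows "univariate_poly (\<lambda>s. f s + g s)"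
proof -
  obtain p q where "f = poly p" "g = poly q"
    using assms unfolding univariate_poly_def by blast
  then show ?thesis
    unfolding univariate_poly_def by (intro exI[of _ "p + q"]) auto
qed

lemma univariate_poly_mult:
  assumes "univariate_poly f" "univariate_poly g"
  shows "univariate_poly (\<lambda>s. f s * g s)"
proof -
  obtain p q where "f = poly p" "g = poly q"
    using assms unfolding univariate_poly_def by blast
  then show ?thesis
    unfolding univariate_poly_def by (intro exI[of _ "p * q"]) auto
qed

lemma univariate_poly_power: "univariate_poly f \<Longrightarrow> univariate_poly (\<lambda>s. f s ^ k)"
  by (induction k) (auto intro: univariate_poly_const univariate_poly_mult)

lemma univariate_poly_sum:
  "(\<And>k. k \<in> K \<Longrightarrow> univariate_poly (f k)) \<Longrightarrow> univariate_poly (\<lambda>s. \<Sum>k\<in>K. f k s)"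
  by (induction K rule: infinite_finite_induct)
     (auto intro: univariate_poly_const univariate_poly_add)

lemma univariate_poly_prod:
  "(\<And>k. k \<in> K \<Longrightarrow> univariate_poly (f k)) \<Longrightarrow> univariate_poly (\<lambda>s. \<Prod>k\<in>K. f k s)"
  by (induction K rule: infinite_finite_induct)
     (auto intro: univariate_poly_const univariate_poly_mult)

lemma univariate_poly_finite_zeros:
  assumes "univariate_poly f" "f a \<noteq> 0"
  shows "finite {s. f s = 0}"
proof -
  obtain p where p: "f = poly p"
    using assms unfolding univariate_poly_def by blast
  then have "p \<noteq> 0"
    using assms(2) by auto
  then show ?thesis
    unfolding p by (rule poly_roots_finite)
qed

text \<open>Otherwise both zero sets would be finite, yet they would cover the infinite field of
  reals.\<close>

lemma univariate_poly_mult_eq_0: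
  assumes "univariate_poly f" "univariate_poly g" "f a \<noteq> 0" "\<And>s. f s * g s = 0"
  shows "g b = 0"
proof (rule ccontr)
  assume "g b \<noteq> 0"
  then have "finite ({s. f s = 0} \<union> {s. g s = 0})"
    using assms univariate_poly_finite_zeros by blast
  moreover have "{s. f s = 0} \<union> {s. g s = 0} = UNIV"
    using assms(4) by auto
  ultimately show False
    using infinite_UNIV_char_0[where 'a = real] by simp
qed

lemma poly_fun_univariate:
  assumes "poly_fun I n f" "\<And>i. i \<in> I \<Longrightarrow> univariate_poly (\<lambda>s. u s i)"
  shows "univariate_poly (\<lambda>s. f (u s))"
proof -
  obtain c where c: "f = (\<lambda>\<theta>. \<Sum>\<beta>\<in>I \<rightarrow>\<^sub>E {..n}. c \<beta> * (\<Prod>i\<in>I. \<theta> i ^ \<beta> i))"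
    using assms(1) by (rule poly_funE)
  show ?thesis
    unfolding c
    by (intro univariate_poly_sum univariate_poly_mult univariate_poly_const
        univariate_poly_prod univariate_poly_power assms(2))
qed

text \<open>Gaussian elimination, one equation at a time: a nonzero pivot in row \<open>b\<close>
  removes one unknown from the other rows, so unknowns stay in excess.\<close>

lemma homogeneous_system_nontrivial_solution:
  fixes M :: "'b \<Rightarrow> 'c \<Rightarrow> real"
  assumes "finite B" "finite A" "card B < card A"
  shows "\<exists>c. (\<exists>a\<in>A. c a \<noteq> 0) \<and> (\<forall>b\<in>B. (\<Sum>a\<in>A. c a * M b a) = 0)"
  using assms
proof (induction B arbitrary: A M rule: finite_induct)
  case empty
  then have "A \<noteq> {}"
    by auto
  then show ?case
    by (intro exI[of _ "\<lambda>_. 1"]) auto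
next
  case (insert b B)
  show ?case
  proof (cases "\<forall>a\<in>A. M b a = 0")
    case True
    obtain c where "\<exists>a\<in>A. c a \<noteq> 0" "\<forall>b\<in>B. (\<Sum>a\<in>A. c a * M b a) = 0"
      using insert.IH[of A M] insert.prems insert.hyps by auto
    with True show ?thesis
      by (intro exI[of _ c]) auto
  next
    case False
    then obtain a0 where a0: "a0 \<in> A" "M b a0 \<noteq> 0"
      by blast
    define A' where "A' = A - {a0}"
    have A': "finite A'" "a0 \<notin> A'" "A = insert a0 A'" "card B < card A'"
      using a0 insert.prems insert.hyps unfolding A'_def by auto
    define M' where "M' b' a = M b' a - M b a / M b a0 * M b' a0" for b' a
    obtain c where c: "\<exists>a\<in>A'. c a \<noteq> 0" "\<forall>b'\<in>B. (\<Sum>a\<in>A'. c a * M' b' a) = 0"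
      using insert.IH[of A' M'] A' by blast
    \<comment> \<open>Back-substitution: the value at the pivot is the one that makes equation
      \<open>b\<close> hold.\<close>
    define c' where "c' = c(a0 := - (\<Sum>a\<in>A'. c a * M b a) / M b a0)"
    have sum: "(\<Sum>a\<in>A. c' a * M b' a) = (\<Sum>a\<in>A'. c a * M' b' a)" for b'
    proof -
      have "(\<Sum>a\<in>A. c' a * M b' a) = c' a0 * M b' a0 + (\<Sum>a\<in>A'. c' a * M b' a)"
        using A' by simp
      also have "(\<Sum>a\<in>A'. c' a * M b' a) = (\<Sum>a\<in>A'. c a * M b' a)"
        using A'(2) unfolding c'_def by (intro sum.cong) auto
      also have "c' a0 * M b' a0 = - (\<Sum>a\<in>A'. c a * (M b a / M b a0 * M b' a0))"
        unfolding c'_def by (simp add: sum_distrib_left sum_divide_distrib mult_ac)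
      finally show ?thesis
        unfolding M'_def by (simp add: right_diff_distrib sum_subtractf)
    qed
    have "M' b a = 0" for a
      using a0 unfolding M'_def by simp
    then have "\<forall>b'\<in>insert b B. (\<Sum>a\<in>A. c' a * M b' a) = 0"
      using c(2) unfolding sum by simp
    moreover have "\<exists>a\<in>A. c' a \<noteq> 0"
      using c(1) A' unfolding c'_def by force
    ultimately show ?thesis
      by blast
  qed
qed

section \<open>Polynomials and irreducible closed sets in the Zariski topology\<close>

lemma polynomial_on_sum:
  "(\<And>k. k \<in> K \<Longrightarrow> polynomial_on W (p k)) \<Longrightarrow> polynomial_on W (\<lambda>f. \<Sum>k\<in>K. p k f)"
  by (induction K rule: infinite_finite_induct)
     (auto intro: polynomial_on.const polynomial_on.add)

lemma polynomial_on_prod: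
  "(\<And>k. k \<in> K \<Longrightarrow> polynomial_on W (p k)) \<Longrightarrow> polynomial_on W (\<lambda>f. \<Prod>k\<in>K. p k f)"
  by (induction K rule: infinite_finite_induct)
     (auto intro: polynomial_on.const polynomial_on.mult)

lemma polynomial_on_power: "polynomial_on W p \<Longrightarrow> polynomial_on W (\<lambda>f. p f ^ n)"
  using polynomial_on_prod[of "{..<n}" W "\<lambda>_. p"] by simp

lemma zariski_closure_eq_0:
  assumes "polynomial_on W p" "\<And>f. f \<in> S \<Longrightarrow> p f = 0" "S \<subseteq> W"
    and "f \<in> zariski_topology W closure_of S"
  shows "p f = 0"
proof -
  have "closedin (zariski_topology W) (zero_locus W {p})"
    unfolding closedin_zariski using assms(1) by blast
  moreover have "S \<subseteq> zero_locus W {p}"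
    using assms(2,3) unfolding zero_locus_def by auto
  ultimately have "zariski_topology W closure_of S \<subseteq> zero_locus W {p}"
    by (intro closure_of_minimal)
  then show ?thesis
    using assms(4) unfolding zero_locus_def by auto
qed

lemma zariski_closed_separating_polynomial:
  assumes "closedin (zariski_topology W) Z" "f \<in> W" "f \<notin> Z"
  obtains p where "polynomial_on W p" "\<And>g. g \<in> Z \<Longrightarrow> p g = 0" "p f \<noteq> 0"
proof -
  obtain P where "P \<subseteq> Collect (polynomial_on W)" "Z = zero_locus W P"
    using assms(1) unfolding closedin_zariski by blast
  then show ?thesis
    using assms(2,3) that unfolding zero_locus_def by blast
qed

text \<open>The coordinate ring of an irreducible set is a domain: \<open>Z\<close> is the union of
  its closed subsets where \<open>p\<close> and where \<open>q\<close> vanishes, and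
  \<open>f0\<close> rules out the first.\<close>

lemma irreducible_closedin_mult_eq_0:
  assumes "irreducible_closedin (zariski_topology W) Z" "polynomial_on W p" "polynomial_on W q"
    and "\<And>f. f \<in> Z \<Longrightarrow> p f * q f = 0" "f0 \<in> Z" "p f0 \<noteq> 0" "f \<in> Z"
  shows "q f = 0"
proof -
  let ?A = "Z \<inter> zero_locus W {p}" and ?B = "Z \<inter> zero_locus W {q}"
  have Z: "closedin (zariski_topology W) Z"
    using assms(1) unfolding irreducible_closedin_def by blast
  then have "Z \<subseteq> W"
    using closedin_subset by fastforce
  have "closedin (zariski_topology W) (zero_locus W {p})"
    "closedin (zariski_topology W) (zero_locus W {q})"
    unfolding closedin_zariski using assms(2,3) by blast+
  with Z have "closedin (zariski_topology W) ?A" "closedin (zariski_topology W) ?B"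
    by (auto intro: closedin_Int)
  moreover have "Z = ?A \<union> ?B"
    using assms(4) \<open>Z \<subseteq> W\<close> unfolding zero_locus_def by auto
  ultimately have "Z = ?A \<or> Z = ?B"
    using assms(1) unfolding irreducible_closedin_def by blast
  moreover have "f0 \<notin> ?A"
    using assms(6) unfolding zero_locus_def by auto
  ultimately have "f \<in> ?B"
    using assms(5,7) by blast
  then show ?thesis
    unfolding zero_locus_def by auto
qed

lemma irreducible_closedin_subtopology:
  assumes "closedin T C"
  shows "irreducible_closedin (subtopology T C) Z \<longleftrightarrow> irreducible_closedin T Z \<and> Z \<subseteq> C"
  unfolding irreducible_closedin_def closedin_closed_subtopology[OF assms] by blast

text \<open>If \<open>g i\<close> vanishes on \<open>Z i\<close> but not on \<open>Z (i + 1)\<close>, then \<open>g 0, \<dots>, g (m - 1)\<close> are algebraically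
  independent on \<open>Z m\<close>: the lowest power of \<open>g (m - 1)\<close> in a relation can be cancelled on \<open>Z m\<close> by
  irreducibility, and restricting to \<open>Z (m - 1)\<close> then leaves a relation between the other
  functions.\<close>

lemma irreducible_chain_monomials_independent:
  assumes "\<And>i. i \<le> m \<Longrightarrow> irreducible_closedin (zariski_topology W) (Z i)"
    and "\<And>i. i < m \<Longrightarrow> Z i \<subseteq> Z (Suc i)"
    and "\<And>i. i < m \<Longrightarrow> polynomial_on W (g i)"
    and "\<And>i f. i < m \<Longrightarrow> f \<in> Z i \<Longrightarrow> g i f = 0"
    and "\<And>i. i < m \<Longrightarrow> \<exists>f\<in>Z (Suc i). g i f \<noteq> 0"
    and "\<And>f. f \<in> Z m \<Longrightarrow> (\<Sum>\<alpha>\<in>{..<m} \<rightarrow>\<^sub>E {..<N}. c \<alpha> * (\<Prod>i<m. g i f ^ \<alpha> i)) = 0"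
    and "\<alpha> \<in> {..<m} \<rightarrow>\<^sub>E {..<N}"
  shows "c \<alpha> = 0"
  using assms
proof (induction m arbitrary: c \<alpha>)
  case 0
  \<comment> \<open>Without functions the relation is the bare coefficient, so evaluating it takes a
    point; irreducible sets are nonempty.\<close>
  then obtain f where "f \<in> Z 0"
    unfolding irreducible_closedin_def by fastforce
  then show ?case
    using 0(6)[of f] 0(7) by simp
next
  case (Suc m)
  let ?B = "{..<m} \<rightarrow>\<^sub>E {..<N}"
  \<comment> \<open>\<open>P e\<close> is the coefficient of the \<open>e\<close>-th power of
    \<open>g m\<close> in the relation, a polynomial in the remaining functions.\<close>
  define P where "P = (\<lambda>e f. \<Sum>\<beta>\<in>?B. c (\<beta>(m := e)) * (\<Prod>i<m. g i f ^ \<beta> i))"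
  have P: "polynomial_on W (P e)" for e
    unfolding P_def
    by (intro polynomial_on_sum polynomial_on.mult polynomial_on.const polynomial_on_prod
        polynomial_on_power Suc.prems(3)) auto
  have split: "(\<Sum>\<alpha>\<in>{..<Suc m} \<rightarrow>\<^sub>E {..<N}. c \<alpha> * (\<Prod>i<Suc m. g i f ^ \<alpha> i))
      = (\<Sum>e<N. g m f ^ e * P e f)" for f
  proof -
    have inj: "inj_on (\<lambda>(e, \<beta>). \<beta>(m := e)) ({..<N} \<times> ?B)"
      by (rule inj_combinator) auto
    have "{..<Suc m} \<rightarrow>\<^sub>E {..<N} = (\<lambda>(e, \<beta>). \<beta>(m := e)) ` ({..<N} \<times> ?B)"
      unfolding lessThan_Suc by (rule PiE_insert_eq)
    then have "(\<Sum>\<alpha>\<in>{..<Suc m} \<rightarrow>\<^sub>E {..<N}. c \<alpha> * (\<Prod>i<Suc m. g i f ^ \<alpha> i))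
        = (\<Sum>(e, \<beta>)\<in>{..<N} \<times> ?B.
             c (\<beta>(m := e)) * (\<Prod>i<Suc m. g i f ^ (\<beta>(m := e)) i))"
      by (simp only: sum.reindex[OF inj]) (intro sum.cong refl, auto)
    also have "\<dots> = (\<Sum>e<N. \<Sum>\<beta>\<in>?B. c (\<beta>(m := e)) * (\<Prod>i<Suc m. g i f ^ (\<beta>(m := e)) i))"
      by (rule sum.cartesian_product[symmetric])
    also have "\<dots> = (\<Sum>e<N. g m f ^ e * P e f)"
      unfolding P_def sum_distrib_left
      by (intro sum.cong refl) (auto simp: mult_ac)
    finally show ?thesis .
  qed
  have coeff_0: "c (\<beta>(m := e)) = 0" if "e < N" "\<beta> \<in> ?B" for e \<beta>
    using that
  proof (induction e arbitrary: \<beta> rule: less_induct)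
    case (less e)
    \<comment> \<open>The relation divided by \<open>g m ^ e\<close>, the coefficients of all lower
      powers being zero by induction.\<close>
    define q where "q = (\<lambda>f. \<Sum>d\<in>{e..<N}. g m f ^ (d - e) * P d f)"
    have "c (\<beta>'(m := d)) = 0" if "d < e" "\<beta>' \<in> ?B" for d \<beta>'
      using less.IH[of d \<beta>'] that less.prems(1) by linarith
    then have low: "P d f = 0" if "d < e" for d f
      unfolding P_def using that by (intro sum.neutral) auto
    have "g m f ^ e * q f = (\<Sum>d<N. g m f ^ d * P d f)" for f
    proof -
      have "(\<Sum>d<N. g m f ^ d * P d f) = (\<Sum>d\<in>{e..<N}. g m f ^ d * P d f)"
        using low by (intro sum.mono_neutral_right) auto
      also have "\<dots> = g m f ^ e * q f"
        unfolding q_def sum_distrib_left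
        by (intro sum.cong) (simp_all flip: mult.assoc power_add)
      finally show ?thesis ..
    qed
    then have vanish: "g m f ^ e * q f = 0" if "f \<in> Z (Suc m)" for f
      using Suc.prems(6)[OF that] unfolding split by simp
    obtain f0 where f0: "f0 \<in> Z (Suc m)" "g m f0 ^ e \<noteq> 0"
      using Suc.prems(5)[of m] by auto
    have gm: "polynomial_on W (\<lambda>f. g m f ^ e)"
      using Suc.prems(3)[of m] polynomial_on_power by simp
    have q: "polynomial_on W q"
      unfolding q_def
      by (intro polynomial_on_sum polynomial_on.mult polynomial_on_power Suc.prems(3) P) auto
    have q_0: "q f = 0" if "f \<in> Z (Suc m)" for f
      using irreducible_closedin_mult_eq_0[OF Suc.prems(1)[OF order_refl] gm q vanish f0 that] .
    have "P e f = 0" if f: "f \<in> Z m" for f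
    proof -
      \<comment> \<open>\<open>g m\<close> vanishes on \<open>Z m\<close> and
        \<open>0 ^ 0 = 1\<close>, so only the term \<open>d = e\<close> survives.\<close>
      have "q f = (\<Sum>d\<in>{e..<N}. if d = e then P e f else 0)"
        unfolding q_def using Suc.prems(4)[OF _ f] by (intro sum.cong) auto
      then show ?thesis
        using q_0[of f] f Suc.prems(2)[of m] less.prems(1) by auto
    qed
    then show ?case
      using Suc.IH[of "\<lambda>\<beta>. c (\<beta>(m := e))" \<beta>] Suc.prems(1-5) less.prems(2)
      unfolding P_def by (simp add: fun_upd_def)
  qed
  have "\<alpha> = (restrict \<alpha> {..<m})(m := \<alpha> m)"
    using Suc.prems(7) by (auto simp: fun_eq_iff PiE_def extensional_def restrict_def less_Suc_eq)
  moreover have \<alpha>: "\<alpha> i < N" if "i < Suc m" for i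
    using PiE_mem[OF Suc.prems(7), of i] that by simp
  then have "restrict \<alpha> {..<m} \<in> ?B"
    unfolding restrict_PiE_iff by simp
  ultimately show ?case
    using coeff_0[of "\<alpha> m" "restrict \<alpha> {..<m}"] \<alpha>[of m] by simp
qed

section \<open>Dimension of a polynomially parametrized set\<close>

text \<open>Linear functionals and constants generate all polynomials on \<open>W\<close>, so only
  pullbacks of linear functionals need checking.\<close>

lemma poly_fun_polynomial_on:
  assumes "finite I" "polynomial_on W p"
    and "\<forall>L. linear_functional_on W L \<longrightarrow> (\<exists>n. poly_fun I n (\<lambda>\<theta>. L (\<Psi> \<theta>)))"
  shows "\<exists>n. poly_fun I n (\<lambda>\<theta>. p (\<Psi> \<theta>))"
  using assms(2)
proof (induction p)
  case (linear L)
  then show ?case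
    using assms(3) by simp
next
  case (const c)
  then show ?case
    using poly_fun_const[OF assms(1)] by blast
next
  case (mult p q)
  then obtain m n where "poly_fun I m (\<lambda>\<theta>. p (\<Psi> \<theta>))" "poly_fun I n (\<lambda>\<theta>. q (\<Psi> \<theta>))"
    by blast
  then show ?case
    using poly_fun_mult[OF assms(1)] by blast
next
  case (add p q)
  then obtain m n where "poly_fun I m (\<lambda>\<theta>. p (\<Psi> \<theta>))" "poly_fun I n (\<lambda>\<theta>. q (\<Psi> \<theta>))"
    by blast
  then have "poly_fun I (max m n) (\<lambda>\<theta>. p (\<Psi> \<theta>))" "poly_fun I (max m n) (\<lambda>\<theta>. q (\<Psi> \<theta>))"
    by (auto intro: poly_fun_mono[OF assms(1)])
  then show ?case
    using poly_fun_add[OF assms(1)] by blast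
qed

text \<open>Since \<open>a * N + 1 \<le> (a + 1) * N\<close>, it suffices that the one surplus
  factor \<open>N\<close> exceeds the constant \<open>(a + 1) ^ D\<close>; this dictates the
  witness.\<close>

lemma exponential_growth:
  fixes a D n :: nat
  assumes "D < n"
  shows "\<exists>N. (a * N + 1) ^ D < N ^ n"
proof
  let ?N = "(a + 1) ^ D + 1"
  have "(a * ?N + 1) ^ D \<le> ((a + 1) * ?N) ^ D"
    by (intro power_mono) auto
  also have "\<dots> = (a + 1) ^ D * ?N ^ D"
    by (rule power_mult_distrib)
  also have "\<dots> < ?N * ?N ^ D"
    by (intro mult_strict_right_mono) auto
  also have "\<dots> = ?N ^ Suc D"
    by simp
  also have "\<dots> \<le> ?N ^ n"
    using assms by (intro power_increasing) auto
  finally show "(a * ?N + 1) ^ D < ?N ^ n" .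
qed

text \<open>The \<open>N ^ n\<close> products with exponents below \<open>N\<close> lie in the span
  of \<open>(n * K * N + 1) ^ card I\<close> monomials, which are fewer for a suitable
  \<open>N\<close>. Bounding degrees in each variable separately makes the second number a plain
  power.\<close>

lemma poly_fun_algebraically_dependent:
  assumes "finite I" "card I < n" "\<And>i. i < n \<Longrightarrow> \<exists>k. poly_fun I k (h i)"
  shows "\<exists>N c. (\<exists>\<alpha>\<in>{..<n} \<rightarrow>\<^sub>E {..<N}. c \<alpha> \<noteq> 0) \<and>
    (\<forall>\<theta>. (\<Sum>\<alpha>\<in>{..<n} \<rightarrow>\<^sub>E {..<N}. c \<alpha> * (\<Prod>i<n. h i \<theta> ^ \<alpha> i)) = 0)"
proof -
  obtain k where k: "\<And>i. i < n \<Longrightarrow> poly_fun I (k i) (h i)"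
    using assms(3) by metis
  define K where "K = (\<Sum>i<n. k i)"
  have K: "poly_fun I K (h i)" if "i < n" for i
    using that unfolding K_def
    by (intro poly_fun_mono[OF assms(1) k]) (auto intro: member_le_sum)
  obtain N where N: "(n * K * N + 1) ^ card I < N ^ n"
    using exponential_growth[OF assms(2)] by blast
  let ?A = "{..<n} \<rightarrow>\<^sub>E {..<N}" and ?B = "I \<rightarrow>\<^sub>E {..n * K * N}"
  have monom: "poly_fun I (n * K * N) (\<lambda>\<theta>. \<Prod>i<n. h i \<theta> ^ \<alpha> i)" if "\<alpha> \<in> ?A" for \<alpha>
  proof -
    have "poly_fun I (K * N) (\<lambda>\<theta>. h i \<theta> ^ \<alpha> i)" if "i < n" for i
    proof (rule poly_fun_mono[OF assms(1) poly_fun_power[OF assms(1) K]])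
      have "\<alpha> i < N"
        using \<open>\<alpha> \<in> ?A\<close> that by auto
      then show "K * \<alpha> i \<le> K * N"
        by simp
    qed (fact that)
    then show ?thesis
      using poly_fun_prod[OF assms(1), of "{..<n}" "K * N"] by (simp add: mult.assoc)
  qed
  \<comment> \<open>Any choice of expansion works: a relation among the coefficient vectors implies
    one among the functions.\<close>
  define C where "C \<alpha> = (SOME c. (\<lambda>\<theta>. \<Prod>i<n. h i \<theta> ^ \<alpha> i)
      = (\<lambda>\<theta>. \<Sum>\<beta>\<in>?B. c \<beta> * (\<Prod>i\<in>I. \<theta> i ^ \<beta> i)))" for \<alpha>
  have "(\<lambda>\<theta>. \<Prod>i<n. h i \<theta> ^ \<alpha> i) = (\<lambda>\<theta>. \<Sum>\<beta>\<in>?B. C \<alpha> \<beta> * (\<Prod>i\<in>I. \<theta> i ^ \<beta> i))"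
    if "\<alpha> \<in> ?A" for \<alpha>
    using someI_ex[OF monom[OF that, unfolded poly_fun_def]] unfolding C_def .
  from fun_cong[OF this] have C: "(\<Prod>i<n. h i \<theta> ^ \<alpha> i)
      = (\<Sum>\<beta>\<in>?B. C \<alpha> \<beta> * (\<Prod>i\<in>I. \<theta> i ^ \<beta> i))" if "\<alpha> \<in> ?A" for \<alpha> \<theta>
    using that .
  have "card ?B < card ?A"
    using N assms(1) by (simp add: card_PiE)
  then obtain c where c: "\<exists>\<alpha>\<in>?A. c \<alpha> \<noteq> 0" "\<forall>\<beta>\<in>?B. (\<Sum>\<alpha>\<in>?A. c \<alpha> * C \<alpha> \<beta>) = 0"
    using homogeneous_system_nontrivial_solution[of ?B ?A "\<lambda>\<beta> \<alpha>. C \<alpha> \<beta>"] assms(1)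
    by (auto simp: finite_PiE)
  have "(\<Sum>\<alpha>\<in>?A. c \<alpha> * (\<Prod>i<n. h i \<theta> ^ \<alpha> i)) = 0" for \<theta>
  proof -
    have "(\<Sum>\<alpha>\<in>?A. c \<alpha> * (\<Prod>i<n. h i \<theta> ^ \<alpha> i))
        = (\<Sum>\<alpha>\<in>?A. \<Sum>\<beta>\<in>?B. c \<alpha> * C \<alpha> \<beta> * (\<Prod>i\<in>I. \<theta> i ^ \<beta> i))"
      using C by (intro sum.cong) (auto simp: sum_distrib_left mult.assoc)
    also have "\<dots> = (\<Sum>\<beta>\<in>?B. (\<Sum>\<alpha>\<in>?A. c \<alpha> * C \<alpha> \<beta>) * (\<Prod>i\<in>I. \<theta> i ^ \<beta> i))"
      by (subst sum.swap) (simp add: sum_distrib_right)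
    also have "\<dots> = 0"
      using c(2) by simp
    finally show ?thesis .
  qed
  with c(1) show ?thesis
    by blast
qed

text \<open>If neither of two closed sets covering the closure contains the image, join a parameter
  missed by one to a parameter missed by the other. On this line, which stays in \<open>S\<close>,
  the separating polynomials have product zero although neither vanishes identically.\<close>

lemma irreducible_closure_image:
  assumes lin: "\<forall>L. linear_functional_on W L \<longrightarrow> (\<exists>n. poly_fun I n (\<lambda>\<theta>. L (\<Psi> \<theta>)))"
    and "finite I" "\<And>\<theta>. \<Psi> \<theta> \<in> W" "S \<noteq> {}"
    and affine: "\<And>\<theta> \<eta> s. \<theta> \<in> S \<Longrightarrow> \<eta> \<in> S \<Longrightarrow> (\<lambda>i. \<theta> i + s * (\<eta> i - \<theta> i)) \<in> S"
  shows "irreducible_closedin (zariski_topology W) (zariski_topology W closure_of (\<Psi> ` S))"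
    (is "irreducible_closedin ?T ?Z")
  unfolding irreducible_closedin_def
proof (intro conjI allI impI)
  have sub: "\<Psi> ` S \<subseteq> ?Z"
    using assms(3) by (intro closure_of_subset) auto
  then show "?Z \<noteq> {}"
    using \<open>S \<noteq> {}\<close> by blast
  fix A B
  assume AB: "closedin ?T A \<and> closedin ?T B \<and> ?Z = A \<union> B"
  have "\<Psi> ` S \<subseteq> A \<or> \<Psi> ` S \<subseteq> B"
  proof (rule ccontr)
    assume "\<not> ?thesis"
    then obtain \<theta> \<eta> where \<theta>: "\<theta> \<in> S" "\<Psi> \<theta> \<notin> A" and \<eta>: "\<eta> \<in> S" "\<Psi> \<eta> \<notin> B"
      by blast
    obtain p where p: "polynomial_on W p" "\<And>f. f \<in> A \<Longrightarrow> p f = 0" "p (\<Psi> \<theta>) \<noteq> 0"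
      using zariski_closed_separating_polynomial[OF _ assms(3) \<theta>(2)] AB by blast
    obtain q where q: "polynomial_on W q" "\<And>f. f \<in> B \<Longrightarrow> q f = 0" "q (\<Psi> \<eta>) \<noteq> 0"
      using zariski_closed_separating_polynomial[OF _ assms(3) \<eta>(2)] AB by blast
    define u where "u = (\<lambda>s i. \<theta> i + s * (\<eta> i - \<theta> i))"
    have "univariate_poly (\<lambda>s. r (\<Psi> (u s)))" if r: "polynomial_on W r" for r
    proof -
      obtain n where n: "poly_fun I n (\<lambda>\<theta>. r (\<Psi> \<theta>))"
        using poly_fun_polynomial_on[OF assms(2) r lin] by blast
      show ?thesis
        unfolding u_def by (rule poly_fun_univariate[OF n univariate_poly_affine])
    qed
    then have "univariate_poly (\<lambda>s. p (\<Psi> (u s)))" "univariate_poly (\<lambda>s. q (\<Psi> (u s)))"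
      using p(1) q(1) by auto
    moreover have "p (\<Psi> (u 0)) \<noteq> 0" "q (\<Psi> (u 1)) \<noteq> 0"
      using p(3) q(3) unfolding u_def by auto
    moreover have "p (\<Psi> (u s)) * q (\<Psi> (u s)) = 0" for s
    proof -
      have "u s \<in> S"
        using affine[OF \<theta>(1) \<eta>(1)] unfolding u_def .
      then have "\<Psi> (u s) \<in> A \<union> B"
        using AB sub by blast
      then show ?thesis
        using p(2) q(2) by auto
    qed
    ultimately show False
      using univariate_poly_mult_eq_0 by blast
  qed
  then have "?Z \<subseteq> A \<or> ?Z \<subseteq> B"
    using AB closure_of_minimal by metis
  then show "?Z = A \<or> ?Z = B"
    using AB by blast
qed simp

text \<open>The witnesses \<open>p\<close> show that fixing the coordinates to \<open>b\<close> one at a time, in order of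
  decreasing rank, shrinks the Zariski closure of the image in each step.\<close>

lemma zariski_dim_parametrized:
  fixes \<Psi> :: "('i \<Rightarrow> real) \<Rightarrow> 'x \<Rightarrow> 'v::real_vector" and rk :: "'i \<Rightarrow> nat"
  assumes fin: "finite I"
    and lin: "\<forall>L. linear_functional_on W L \<longrightarrow> (\<exists>n. poly_fun I n (\<lambda>\<theta>. L (\<Psi> \<theta>)))"
    and M: "M \<subseteq> W" "\<And>\<theta>. \<Psi> \<theta> \<in> M"
    and dense: "\<And>p f. polynomial_on W p \<Longrightarrow> (\<And>\<theta>. p (\<Psi> \<theta>) = 0) \<Longrightarrow> f \<in> M \<Longrightarrow> p f = 0"
    and sep: "\<And>i. i \<in> I \<Longrightarrow> \<exists>p. polynomial_on W p \<and> p (\<Psi> (b(i := b i + 1))) \<noteq> 0 \<and>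
        (\<forall>\<theta>. \<theta> i = b i \<longrightarrow> (\<forall>j\<in>I. rk i < rk j \<longrightarrow> \<theta> j = b j) \<longrightarrow> p (\<Psi> \<theta>) = 0)"
  shows "zariski_dim W M = enat (card I)"
proof -
  let ?T = "zariski_topology W"
  let ?C = "?T closure_of M"
  have irred: "irreducible_closedin (subtopology ?T ?C) Z \<longleftrightarrow> irreducible_closedin ?T Z \<and> Z \<subseteq> ?C" for Z
    by (simp add: irreducible_closedin_subtopology)
  have upper: "n \<le> card I" if chain: "\<forall>i\<le>n. irreducible_closedin (subtopology ?T ?C) (Z i)"
    "\<forall>i<n. Z i \<subset> Z (Suc i)" for n Z
  proof (rule ccontr)
    assume "\<not> n \<le> card I"
    then have n: "card I < n"
      by simp
    have Z: "irreducible_closedin ?T (Z i)" "Z i \<subseteq> ?C" if "i \<le> n" for i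
      using chain(1) that unfolding irred by auto
    have "\<exists>g. polynomial_on W g \<and> (\<forall>f\<in>Z i. g f = 0) \<and> (\<exists>f\<in>Z (Suc i). g f \<noteq> 0)" if i: "i < n" for i
    proof -
      obtain f where f: "f \<in> Z (Suc i)" "f \<notin> Z i"
        using chain(2) i by blast
      have "Z (Suc i) \<subseteq> W"
        using Z(2)[of "Suc i"] i closure_of_subset_topspace[of ?T M] by auto
      moreover have "closedin ?T (Z i)"
        using Z(1)[of i] i unfolding irreducible_closedin_def by auto
      ultimately obtain p where "polynomial_on W p" "\<And>g. g \<in> Z i \<Longrightarrow> p g = 0" "p f \<noteq> 0"
        using f by (elim zariski_closed_separating_polynomial[where f = f]) auto
      then show ?thesis
        using f by blast
    qed
    then obtain g where g: "\<And>i. i < n \<Longrightarrow> polynomial_on W (g i)"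
      "\<And>i f. i < n \<Longrightarrow> f \<in> Z i \<Longrightarrow> g i f = 0" "\<And>i. i < n \<Longrightarrow> \<exists>f\<in>Z (Suc i). g i f \<noteq> 0"
      by metis
    have "\<exists>k. poly_fun I k (\<lambda>\<theta>. g i (\<Psi> \<theta>))" if "i < n" for i
      using poly_fun_polynomial_on[OF fin g(1)[OF that] lin] .
    from poly_fun_algebraically_dependent[OF fin n, of "\<lambda>i \<theta>. g i (\<Psi> \<theta>)", OF this]
    obtain N c where Nc: "\<exists>\<alpha>\<in>{..<n} \<rightarrow>\<^sub>E {..<N}. c \<alpha> \<noteq> 0"
      "\<And>\<theta>. (\<Sum>\<alpha>\<in>{..<n} \<rightarrow>\<^sub>E {..<N}. c \<alpha> * (\<Prod>i<n. g i (\<Psi> \<theta>) ^ \<alpha> i)) = 0"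
      by blast
    \<comment> \<open>A relation on the image of \<open>\<Psi>\<close> passes to \<open>M\<close> by
      density, then to its closure, which contains \<open>Z n\<close>.\<close>
    define p where "p = (\<lambda>f. \<Sum>\<alpha>\<in>{..<n} \<rightarrow>\<^sub>E {..<N}. c \<alpha> * (\<Prod>i<n. g i f ^ \<alpha> i))"
    have p: "polynomial_on W p"
      unfolding p_def
      by (intro polynomial_on_sum polynomial_on.mult polynomial_on.const polynomial_on_prod
          polynomial_on_power g) auto
    then have "p f = 0" if "f \<in> M" for f
      using dense[OF p _ that] Nc(2) unfolding p_def by blast
    then have "p f = 0" if "f \<in> Z n" for f
      using zariski_closure_eq_0[OF p _ M(1)] Z(2)[of n] that by blast
    then have "\<forall>\<alpha>\<in>{..<n} \<rightarrow>\<^sub>E {..<N}. c \<alpha> = 0"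
      using irreducible_chain_monomials_independent[where m = n and W = W and Z = Z and g = g and N = N and c = c, OF Z(1)] chain(2) g
      unfolding p_def by blast
    then show False
      using Nc(1) by blast
  qed
  have lower: "\<exists>Z. (\<forall>i\<le>card I. irreducible_closedin (subtopology ?T ?C) (Z i)) \<and>
      (\<forall>i<card I. Z i \<subset> Z (Suc i))"
  proof -
    obtain ys where ys: "set ys = I" "distinct ys"
      using finite_distinct_list[OF fin] by blast
    \<comment> \<open>Ties of equal rank are ordered arbitrarily; hence \<open>sep\<close> lets a
      witness rely only on coordinates of strictly larger rank being fixed.\<close>
    define xs where "xs = sort_key rk ys"
    have xs: "set xs = I" "distinct xs" "sorted (map rk xs)" "length xs = card I"
      using ys distinct_card[of ys] unfolding xs_def by auto
    define S where "S k = {\<theta>. \<forall>j\<in>set (drop k xs). \<theta> j = b j}" for k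
    define Z where "Z k = ?T closure_of (\<Psi> ` S k)" for k
    have W: "\<Psi> \<theta> \<in> W" for \<theta>
      using M by blast
    have S_mono: "S k \<subseteq> S (Suc k)" for k
      unfolding S_def using set_drop_subset_set_drop[of k "Suc k" xs] by auto
    have "irreducible_closedin (subtopology ?T ?C) (Z k)" for k
      unfolding irred
    proof
      have b_mem: "b \<in> S k"
        unfolding S_def by simp
      show "irreducible_closedin ?T (Z k)"
        unfolding Z_def
        by (rule irreducible_closure_image[OF lin fin W]) (use b_mem in \<open>auto simp: S_def\<close>)
      show "Z k \<subseteq> ?C"
        unfolding Z_def using M(2) by (intro closure_of_mono) auto
    qed
    moreover have "Z k \<subset> Z (Suc k)" if "k < card I" for k
    proof
      show "Z k \<subseteq> Z (Suc k)"
        unfolding Z_def using S_mono by (intro closure_of_mono image_mono)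
      have k: "k < length xs" "xs ! k \<in> I"
        using that xs by auto
      obtain p where p: "polynomial_on W p" "p (\<Psi> (b(xs ! k := b (xs ! k) + 1))) \<noteq> 0"
        "\<And>\<theta>. \<theta> (xs ! k) = b (xs ! k) \<Longrightarrow> (\<forall>j\<in>I. rk (xs ! k) < rk j \<longrightarrow> \<theta> j = b j) \<Longrightarrow> p (\<Psi> \<theta>) = 0"
        using sep[OF k(2)] by blast
      have drop: "drop k xs = xs ! k # drop (Suc k) xs"
        using k(1) by (rule Cons_nth_drop_Suc[symmetric])
      have "p (\<Psi> \<theta>) = 0" if "\<theta> \<in> S k" for \<theta>
      proof (rule p(3))
        show "\<theta> (xs ! k) = b (xs ! k)"
          using that unfolding S_def drop by simp
        show "\<forall>j\<in>I. rk (xs ! k) < rk j \<longrightarrow> \<theta> j = b j"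
        proof (intro ballI impI)
          fix j
          assume j: "j \<in> I" "rk (xs ! k) < rk j"
          then obtain l where l: "l < length xs" "j = xs ! l"
            using xs(1) by (metis in_set_conv_nth)
          have "\<not> l < k"
            using j(2) l k(1) sorted_nth_mono[OF xs(3), of l k] by auto
          then have "j \<in> set (drop k xs)"
            using l by (auto simp: in_set_conv_nth intro!: exI[of _ "l - k"])
          then show "\<theta> j = b j"
            using that unfolding S_def by blast
        qed
      qed
      then have "p f = 0" if "f \<in> Z k" for f
        using zariski_closure_eq_0[OF p(1), of "\<Psi> ` S k" f] W that unfolding Z_def by blast
      moreover have "\<Psi> (b(xs ! k := b (xs ! k) + 1)) \<in> Z (Suc k)"
      proof -
        have "xs ! k \<notin> set (drop (Suc k) xs)"
          using distinct_drop[OF xs(2), of k] unfolding drop by simp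
        then have "b(xs ! k := b (xs ! k) + 1) \<in> S (Suc k)"
          unfolding S_def by auto
        moreover have "\<Psi> ` S (Suc k) \<subseteq> Z (Suc k)"
          unfolding Z_def using W by (intro closure_of_subset) auto
        ultimately show ?thesis
          by blast
      qed
      ultimately show "Z k \<noteq> Z (Suc k)"
        using p(2) by blast
    qed
    ultimately show ?thesis
      by blast
  qed
  show ?thesis
    unfolding zariski_dim_def krull_dim_def
  proof (intro antisym SUP_least)
    show "enat (card I) \<le> (SUP n\<in>{n. \<exists>Z. (\<forall>i\<le>n. irreducible_closedin (subtopology ?T ?C) (Z i)) \<and>
        (\<forall>i<n. Z i \<subset> Z (Suc i))}. enat n)"
      using lower by (intro SUP_upper) blast
  qed (use upper in auto)
qed

section \<open>Lightning self-attention in terms of the attention matrix\<close>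

text \<open>Passing to the product \<open>transpose K ** Q\<close> removes the freedom of changing
  basis in the inner dimension.\<close>

definition attention_map :: "real^'d^'d \<Rightarrow> real^'d^'e \<Rightarrow> real^'t^'d \<Rightarrow> real^'t^'e" where
  "attention_map A V = (\<lambda>X. V ** X ** transpose X ** A ** X)"

lemma lightning_attention_eq:
  "lightning_attention Q K V = attention_map (transpose K ** Q) V"
  unfolding lightning_attention_def attention_map_def by (simp add: matrix_mul_assoc)

lemma attention_map_entry:
  "attention_map A V X $ l $ j = (\<Sum>n\<in>UNIV. (\<Sum>i\<in>UNIV. V $ l $ i * X $ i $ n) *
     (\<Sum>m\<in>UNIV. \<Sum>k\<in>UNIV. X $ m $ n * A $ m $ k * X $ k $ j))"
proof -
  have "attention_map A V X = (V ** X) ** (transpose X ** (A ** X))"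
    unfolding attention_map_def by (simp add: matrix_mul_assoc)
  then show ?thesis
    by (simp add: matrix_matrix_mult_def transpose_def sum_distrib_left mult.assoc)
qed

text \<open>The map is linear in each of \<open>A\<close> and \<open>V\<close>, so reciprocal
  factors cancel; this is the source of the \<open>- 1\<close> in the dimension.\<close>

lemma attention_map_scale:
  assumes "c \<noteq> 0" "\<And>m k. A' $ m $ k = c * A $ m $ k" "\<And>l i. V' $ l $ i = V $ l $ i / c"
  shows "attention_map A' V' = (attention_map A V :: real^'t^'d \<Rightarrow> real^'t^'e)"
proof -
  have "(\<Sum>i\<in>UNIV. V' $ l $ i * X $ i $ n) *
      (\<Sum>m\<in>UNIV. \<Sum>k\<in>UNIV. X $ m $ n * A' $ m $ k * X $ k $ j)
    = (\<Sum>i\<in>UNIV. V $ l $ i * X $ i $ n) *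
      (\<Sum>m\<in>UNIV. \<Sum>k\<in>UNIV. X $ m $ n * A $ m $ k * X $ k $ j)" for X :: "real^'t^'d" and l n j
  proof -
    have "(\<Sum>i\<in>UNIV. V' $ l $ i * X $ i $ n) = (\<Sum>i\<in>UNIV. V $ l $ i * X $ i $ n) / c"
      by (simp add: assms(3) sum_divide_distrib)
    moreover have "(\<Sum>m\<in>UNIV. \<Sum>k\<in>UNIV. X $ m $ n * A' $ m $ k * X $ k $ j)
        = c * (\<Sum>m\<in>UNIV. \<Sum>k\<in>UNIV. X $ m $ n * A $ m $ k * X $ k $ j)"
      by (simp add: assms(2) sum_distrib_left mult_ac)
    ultimately show ?thesis
      using assms(1) by simp
  qed
  then show ?thesis
    by (intro ext) (simp add: vec_eq_iff attention_map_entry)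
qed

lemma Sym3_add:
  assumes "f \<in> Sym3" "g \<in> Sym3"
  shows "(\<lambda>X. f X + g X) \<in> Sym3"
proof -
  \<comment> \<open>Two summands are indexed by the booleans so that closure under finite sums
    applies.\<close>
  have "cubic_form (\<lambda>X. (if b then f X else g X) $ i $ j)" for b i j
    using assms by (cases b) (simp_all add: Sym3_def)
  then have "cubic_form (\<lambda>X. \<Sum>b\<in>UNIV. (if b then f X else g X) $ i $ j)" for i j
    by (intro cubic_form_sum) auto
  then show ?thesis
    unfolding Sym3_def by (simp add: UNIV_bool add.commute)
qed

lemma Sym3_scale:
  assumes "f \<in> Sym3"
  shows "(\<lambda>X. c *\<^sub>R f X) \<in> Sym3"
proof -
  have "cubic_form (\<lambda>X. c * f X $ i $ j)" for i j
  proof -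
    obtain a where a: "\<And>X. f X $ i $ j = (\<Sum>p\<in>UNIV. \<Sum>q\<in>UNIV. \<Sum>r\<in>UNIV.
        a p q r * X $ fst p $ snd p * X $ fst q $ snd q * X $ fst r $ snd r)"
      using assms unfolding Sym3_def cubic_form_def by blast
    show ?thesis
      unfolding cubic_form_def a
      by (intro exI[of _ "\<lambda>p q r. c * a p q r"]) (simp add: sum_distrib_left mult.assoc)
  qed
  then show ?thesis
    unfolding Sym3_def by simp
qed

lemma linear_functional_on_Sym3_sum:
  fixes h :: "'k \<Rightarrow> real^'t^'d \<Rightarrow> real^'t^'e"
  assumes L: "linear_functional_on Sym3 L" and "finite K"
    and h: "\<And>k. h k \<in> Sym3"
  shows "(\<lambda>X. \<Sum>k\<in>K. c k *\<^sub>R h k X) \<in> Sym3 \<and>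
    L (\<lambda>X. \<Sum>k\<in>K. c k *\<^sub>R h k X) = (\<Sum>k\<in>K. c k * L (h k))"
  using assms(2)
proof (induction K rule: finite_induct)
  case empty
  \<comment> \<open>The zero map is reached as 0 times a member, since \<open>L\<close> is linear
    only on \<open>Sym3\<close>.\<close>
  have "(\<lambda>X. 0 *\<^sub>R h k X) \<in> Sym3" "L (\<lambda>X. 0 *\<^sub>R h k X) = 0 * L (h k)" for k
    using L h[of k] Sym3_scale[OF h] unfolding linear_functional_on_def by blast+
  then show ?case
    by simp
next
  case (insert k K)
  have "(\<lambda>X. c k *\<^sub>R h k X) \<in> Sym3" "L (\<lambda>X. c k *\<^sub>R h k X) = c k * L (h k)"
    using L h[of k] Sym3_scale[OF h] unfolding linear_functional_on_def by blast+
  moreover have "L (\<lambda>X. f X + g X) = L f + L g" if "f \<in> Sym3" "g \<in> Sym3" for f g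
    using L that unfolding linear_functional_on_def by blast
  ultimately show ?case
    using insert by (simp add: Sym3_add)
qed

text \<open>The map that multiplies \<open>V $ l $ i * A $ m $ k\<close> in the expansion of
  \<open>attention_map\<close>. This finite family does not depend on \<open>A\<close> and
  \<open>V\<close>, so an abstract linear functional becomes a polynomial in their entries.\<close>

definition attention_monomial :: "'e \<times> 'd \<times> 'd \<times> 'd \<Rightarrow> real^'t^'d \<Rightarrow> real^'t^'e" where
  "attention_monomial = (\<lambda>(l, i, m, k) X. \<chi> l' j.
     if l' = l then \<Sum>n\<in>UNIV. X $ i $ n * X $ m $ n * X $ k $ j else 0)"

lemma attention_monomial_in_Sym3:
  "(attention_monomial q :: real^'t^'d \<Rightarrow> real^'t^'e) \<in> Sym3"
proof -
  obtain l i m k where q: "q = (l, i, m, k)"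
    using prod_cases4 by blast
  have "cubic_form (\<lambda>X. (attention_monomial q :: real^'t^'d \<Rightarrow> real^'t^'e) X $ l' $ j)" for l' j
  proof -
    have *: "(\<lambda>X. (attention_monomial q :: real^'t^'d \<Rightarrow> real^'t^'e) X $ l' $ j)
        = (\<lambda>X. \<Sum>n\<in>UNIV. (if l' = l then 1 else 0) * X $ i $ n * X $ m $ n * X $ k $ j)"
      unfolding attention_monomial_def q by (auto simp: fun_eq_iff)
    show ?thesis
      unfolding *
      by (intro cubic_form_sum cubic_form_monomial[where c = "if l' = l then 1 else 0"
            and p = "(i, _)" and q = "(m, _)" and r = "(k, j)"]) auto
  qed
  then show ?thesis
    unfolding Sym3_def by blast
qed

lemma attention_map_eq_sum:
  "(attention_map A V :: real^'t^'d \<Rightarrow> real^'t^'e) = (\<lambda>X. \<Sum>q\<in>UNIV.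
     (case q of (l, i, m, k) \<Rightarrow> V $ l $ i * A $ m $ k) *\<^sub>R attention_monomial q X)"
proof (intro ext)
  fix X :: "real^'t^'d"
  have "(\<Sum>q\<in>UNIV. (case q of (l, i, m, k) \<Rightarrow> V $ l $ i * A $ m $ k) *\<^sub>R attention_monomial q X) $ l' $ j
      = attention_map A V X $ l' $ j" for l' j
  proof -
    let ?t = "\<lambda>i m k. V $ l' $ i * A $ m $ k * (\<Sum>n\<in>UNIV. X $ i $ n * X $ m $ n * X $ k $ j)"
    have "(\<Sum>q\<in>UNIV. (case q of (l, i, m, k) \<Rightarrow> V $ l $ i * A $ m $ k) *\<^sub>R attention_monomial q X) $ l' $ j
        = (\<Sum>l\<in>UNIV. \<Sum>i\<in>UNIV. \<Sum>m\<in>UNIV. \<Sum>k\<in>UNIV. if l = l' then ?t i m k else 0)"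
      unfolding UNIV_Times_UNIV[symmetric] sum.cartesian_product attention_monomial_def
      by (auto intro!: sum.cong)
    also have "\<dots> = (\<Sum>l\<in>UNIV. if l = l' then \<Sum>i\<in>UNIV. \<Sum>m\<in>UNIV. \<Sum>k\<in>UNIV. ?t i m k else 0)"
      by (intro sum.cong) auto
    also have "\<dots> = (\<Sum>i\<in>UNIV. \<Sum>m\<in>UNIV. \<Sum>k\<in>UNIV. ?t i m k)"
      by simp
    also have "\<dots> = (\<Sum>i\<in>UNIV. \<Sum>m\<in>UNIV. \<Sum>k\<in>UNIV. \<Sum>n\<in>UNIV.
        (V $ l' $ i * X $ i $ n) * (X $ m $ n * A $ m $ k * X $ k $ j))"
      by (simp add: sum_distrib_left mult_ac)
    also have "\<dots> = (\<Sum>i\<in>UNIV. \<Sum>m\<in>UNIV. \<Sum>n\<in>UNIV. \<Sum>k\<in>UNIV.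
        (V $ l' $ i * X $ i $ n) * (X $ m $ n * A $ m $ k * X $ k $ j))"
      by (intro sum.cong refl sum.swap)
    also have "\<dots> = (\<Sum>i\<in>UNIV. \<Sum>n\<in>UNIV. \<Sum>m\<in>UNIV. \<Sum>k\<in>UNIV.
        (V $ l' $ i * X $ i $ n) * (X $ m $ n * A $ m $ k * X $ k $ j))"
      by (intro sum.cong refl sum.swap)
    also have "\<dots> = (\<Sum>n\<in>UNIV. \<Sum>i\<in>UNIV. \<Sum>m\<in>UNIV. \<Sum>k\<in>UNIV.
        (V $ l' $ i * X $ i $ n) * (X $ m $ n * A $ m $ k * X $ k $ j))"
      by (rule sum.swap)
    also have "\<dots> = attention_map A V X $ l' $ j"
      unfolding attention_map_entry by (simp only: sum_product) (simp add: sum_distrib_left)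
    finally show ?thesis .
  qed
  then show "attention_map A V X = (\<Sum>q\<in>UNIV.
      (case q of (l, i, m, k) \<Rightarrow> V $ l $ i * A $ m $ k) *\<^sub>R attention_monomial q X)"
    by (simp add: vec_eq_iff)
qed

lemma linear_functional_attention_map:
  assumes "linear_functional_on Sym3 L"
  shows "L (attention_map A V) =
    (\<Sum>(l, i, m, k)\<in>UNIV. V $ l $ i * A $ m $ k * L (attention_monomial (l, i, m, k)))"
  unfolding attention_map_eq_sum
  using linear_functional_on_Sym3_sum[where h = attention_monomial, OF assms finite attention_monomial_in_Sym3]
  by (simp add: case_prod_unfold)

text \<open>The input with columns \<open>x\<close> and \<open>y\<close> and zeros elsewhere; this is where \<open>t \<ge> 2\<close> enters.
  Subtracting the value for \<open>x = 0\<close> removes the contribution of the token \<open>y\<close> attending to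
  itself.\<close>

definition two_tokens :: "'t \<Rightarrow> 't \<Rightarrow> real^'d \<Rightarrow> real^'d \<Rightarrow> real^'t^'d" where
  "two_tokens n1 n0 x y = (\<chi> i n. if n = n1 then x $ i else if n = n0 then y $ i else 0)"

definition token_interaction ::
    "'t \<Rightarrow> 't \<Rightarrow> 'e \<Rightarrow> real^'d \<Rightarrow> real^'d \<Rightarrow> (real^'t^'d \<Rightarrow> real^'t^'e) \<Rightarrow> real" where
  "token_interaction n1 n0 l x y f =
     f (two_tokens n1 n0 x y) $ l $ n0 - f (two_tokens n1 n0 0 y) $ l $ n0"

lemma polynomial_on_token_interaction: "polynomial_on Sym3 (token_interaction n1 n0 l x y)"
  by (rule polynomial_on.linear)
     (simp add: linear_functional_on_def token_interaction_def algebra_simps)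

lemma token_interaction_attention_map:
  assumes "n1 \<noteq> n0"
  shows "token_interaction n1 n0 l x y (attention_map A V) = (V *v x) $ l * (x \<bullet> (A *v y))"
proof -
  let ?P = "\<lambda>x. (\<Sum>i\<in>UNIV. V $ l $ i * x $ i) * (\<Sum>m\<in>UNIV. \<Sum>k\<in>UNIV. x $ m * A $ m $ k * y $ k)"
  have T: "attention_map A V (two_tokens n1 n0 x y) $ l $ n0 = ?P x + ?P y" for x
  proof -
    have "attention_map A V (two_tokens n1 n0 x y) $ l $ n0
        = (\<Sum>n\<in>UNIV. (if n = n1 then ?P x else 0) + (if n = n0 then ?P y else 0))"
      unfolding attention_map_entry using assms
      by (intro sum.cong refl) (auto simp: two_tokens_def)
    then show ?thesis
      by (simp add: sum.distrib)
  qed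
  show ?thesis
    unfolding token_interaction_def T
    by (simp add: matrix_vector_mult_def inner_vec_def sum_distrib_left mult.assoc)
qed

lemma token_interaction_axis:
  assumes "n1 \<noteq> n0"
  shows "token_interaction n1 n0 l (axis i 1) (axis k 1) (attention_map A V) = V $ l $ i * A $ i $ k"
  by (simp add: token_interaction_attention_map[OF assms] matrix_vector_mult_basis column_def
      inner_axis')

text \<open>If row \<open>l\<close> of \<open>V\<close> is the \<open>i\<close>-th unit row, the
  interaction of \<open>x\<close> with \<open>axis k 1\<close> is \<open>x $ i\<close> times the
  pairing of \<open>x\<close> with column \<open>k\<close> of \<open>A\<close>. At
  \<open>axis j 1\<close> with \<open>j \<noteq> i\<close> this is zero, so \<open>axis i 1\<close>
  is added to the input and its own value subtracted afterwards.\<close>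

definition attention_coordinate ::
    "'t \<Rightarrow> 't \<Rightarrow> 'e \<Rightarrow> 'd \<Rightarrow> 'd \<Rightarrow> 'd \<Rightarrow> (real^'t^'d \<Rightarrow> real^'t^'e) \<Rightarrow> real" where
  "attention_coordinate n1 n0 l i j k f =
     token_interaction n1 n0 l (if j = i then axis i 1 else axis i 1 + axis j 1) (axis k 1) f -
     (if j = i then 0 else token_interaction n1 n0 l (axis i 1) (axis k 1) f)"

lemma polynomial_on_attention_coordinate:
  "polynomial_on Sym3 (attention_coordinate n1 n0 l i j k)"
proof -
  have "polynomial_on Sym3 (\<lambda>f. token_interaction n1 n0 l x y f + c * token_interaction n1 n0 l x' y' f)"
    for x y x' y' c
    by (intro polynomial_on.add polynomial_on.mult polynomial_on.const polynomial_on_token_interaction)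
  from this[of "if j = i then axis i 1 else axis i 1 + axis j 1" "axis k 1"
      "if j = i then 0 else - 1" "axis i 1" "axis k 1"]
  show ?thesis
    by (cases "j = i") (simp_all add: attention_coordinate_def[abs_def])
qed

lemma attention_coordinate_attention_map:
  assumes "n1 \<noteq> n0" "\<And>i'. V $ l $ i' = (if i' = i then 1 else 0)"
  shows "attention_coordinate n1 n0 l i j k (attention_map A V) = A $ j $ k"
  by (simp add: attention_coordinate_def token_interaction_attention_map[OF assms(1)] assms(2)
      matrix_vector_right_distrib matrix_vector_mult_basis column_def inner_add_left inner_axis')

section \<open>A parametrization without redundant parameters\<close>

text \<open>Generically the rows of \<open>A = K\<^sup>T Q\<close> with index in a set \<open>R\<close> of size \<open>min a d\<close> span
  the row space, and rescaling makes one entry of \<open>V\<close> equal to \<open>1\<close>. The parameter \<open>Inl (j, k)\<close>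
  is an entry of \<open>A\<close> if \<open>j \<in> R\<close>, and the coefficient of row \<open>k\<close> in row \<open>j\<close> if \<open>j \<notin> R\<close> and
  \<open>k \<in> R\<close>.\<close>

definition param_A :: "'d set \<Rightarrow> ('d \<times> 'd + 'e \<times> 'd \<Rightarrow> real) \<Rightarrow> real^'d^'d" where
  "param_A R \<theta> = (\<chi> j k. if j \<in> R then \<theta> (Inl (j, k)) else \<Sum>i\<in>R. \<theta> (Inl (j, i)) * \<theta> (Inl (i, k)))"

definition param_V :: "'e \<Rightarrow> 'd \<Rightarrow> ('d \<times> 'd + 'e \<times> 'd \<Rightarrow> real) \<Rightarrow> real^'d^'e" where
  "param_V l0 i0 \<theta> = (\<chi> l i. if (l, i) = (l0, i0) then 1 else \<theta> (Inr (l, i)))"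

definition param_index :: "'d set \<Rightarrow> 'e \<Rightarrow> 'd \<Rightarrow> ('d \<times> 'd + 'e \<times> 'd) set" where
  "param_index R l0 i0 = Inl ` {(j, k). j \<in> R \<or> k \<in> R} \<union> Inr ` (UNIV - {(l0, i0)})"

text \<open>The index pairs left out for \<open>A\<close> form the square block with both indices
  outside \<open>R\<close>.\<close>

lemma card_param_index:
  fixes R :: "'d::finite set" and l0 :: "'e::finite"
  shows "card (param_index R l0 i0)
    = CARD('d)^2 - (CARD('d) - card R)^2 + (CARD('d) * CARD('e) - 1)"
proof -
  have "card (Inl ` {(j, k). j \<in> R \<or> k \<in> R} :: ('d \<times> 'd + 'e \<times> 'd) set)
      = card {(j, k). j \<in> R \<or> k \<in> R}"
    by (rule card_image) simp
  also have "\<dots> = card (UNIV - (UNIV - R) \<times> (UNIV - R))"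
    by (rule arg_cong[where f = card]) auto
  also have "\<dots> = CARD('d)^2 - (CARD('d) - card R)^2"
    by (simp add: card_Diff_subset card_cartesian_product power2_eq_square)
  finally have 1: "card (Inl ` {(j, k). j \<in> R \<or> k \<in> R} :: ('d \<times> 'd + 'e \<times> 'd) set)
      = CARD('d)^2 - (CARD('d) - card R)^2" .
  have "card (Inr ` (UNIV - {(l0, i0)}) :: ('d \<times> 'd + 'e \<times> 'd) set) = card (UNIV - {(l0, i0)})"
    by (rule card_image) simp
  also have "\<dots> = CARD('d) * CARD('e) - 1"
    by (simp add: card_Diff_subset card_cartesian_product mult.commute)
  finally have 2: "card (Inr ` (UNIV - {(l0, i0)}) :: ('d \<times> 'd + 'e \<times> 'd) set)
      = CARD('d) * CARD('e) - 1" .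
  show ?thesis
    unfolding param_index_def
    by (subst card_Un_disjoint) (auto simp: 1 2)
qed

lemma poly_fun_attention_map_param:
  fixes R :: "'d::finite set" and l0 :: "'e::finite"
  assumes "linear_functional_on Sym3 (L :: (real^'t^'d \<Rightarrow> real^'t^'e) \<Rightarrow> real)"
  shows "\<exists>n. poly_fun (param_index R l0 i0) n (\<lambda>\<theta>. L (attention_map (param_A R \<theta>) (param_V l0 i0 \<theta>)))"
proof -
  let ?I = "param_index R l0 i0"
  have fin: "finite ?I"
    by simp
  have A: "poly_fun ?I 2 (\<lambda>\<theta>. param_A R \<theta> $ j $ k)" for j k
  proof (cases "j \<in> R")
    case True
    then have "poly_fun ?I 1 (\<lambda>\<theta>. \<theta> (Inl (j, k)))"
      by (intro poly_fun_var fin) (auto simp: param_index_def)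
    then show ?thesis
      using True by (simp add: param_A_def poly_fun_mono[OF fin])
  next
    case False
    have "poly_fun ?I (1 + 1) (\<lambda>\<theta>. \<Sum>i\<in>R. \<theta> (Inl (j, i)) * \<theta> (Inl (i, k)))"
      by (intro poly_fun_sum poly_fun_mult poly_fun_var fin finite) (auto simp: param_index_def)
    then show ?thesis
      using False by (simp add: param_A_def numeral_2_eq_2)
  qed
  have V: "poly_fun ?I 1 (\<lambda>\<theta>. param_V l0 i0 \<theta> $ l $ i)" for l i
  proof (cases "(l, i) = (l0, i0)")
    case True
    then show ?thesis
      by (simp add: param_V_def poly_fun_const[OF fin])
  next
    case False
    then have "poly_fun ?I 1 (\<lambda>\<theta>. \<theta> (Inr (l, i)))"
      by (intro poly_fun_var fin) (auto simp: param_index_def)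
    moreover have "(\<lambda>\<theta>. param_V l0 i0 \<theta> $ l $ i) = (\<lambda>\<theta>. \<theta> (Inr (l, i)))"
      using False by (auto simp: param_V_def)
    ultimately show ?thesis
      by simp
  qed
  have "poly_fun ?I 3 (\<lambda>\<theta>. param_V l0 i0 \<theta> $ l $ i * param_A R \<theta> $ m $ k * c)" for l i m k c
    using poly_fun_mult[OF fin poly_fun_mult[OF fin V A] poly_fun_const[OF fin, of 0]]
    by (simp add: numeral_3_eq_3)
  then have "poly_fun ?I 3 (\<lambda>\<theta>. \<Sum>q\<in>UNIV. case q of (l, i, m, k) \<Rightarrow>
      param_V l0 i0 \<theta> $ l $ i * param_A R \<theta> $ m $ k * L (attention_monomial (l, i, m, k)))"
    by (intro poly_fun_sum fin finite) (simp add: case_prod_unfold)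
  then show ?thesis
    unfolding linear_functional_attention_map[OF assms] by blast
qed

section \<open>Density of the parametrized family\<close>

lemma univariate_poly_attention_map:
  assumes "polynomial_on Sym3 p"
    and "\<And>m k. univariate_poly (\<lambda>s. A s $ m $ k)" "\<And>l i. univariate_poly (\<lambda>s. V s $ l $ i)"
  shows "univariate_poly (\<lambda>s. p (attention_map (A s) (V s)))"
  using assms(1)
proof (induction p)
  case (linear L)
  show ?case
    unfolding linear_functional_attention_map[OF linear] case_prod_unfold
    by (intro univariate_poly_sum univariate_poly_mult univariate_poly_const assms(2,3))
qed (auto intro: univariate_poly_const univariate_poly_add univariate_poly_mult)

lemma univariate_poly_det:
  assumes "\<And>i j. univariate_poly (\<lambda>s. B s $ i $ j)"
  shows "univariate_poly (\<lambda>s. det (B s))"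
  unfolding det_def
  by (intro univariate_poly_sum univariate_poly_mult univariate_poly_const univariate_poly_prod assms)

definition rows_spanned_by :: "'d set \<Rightarrow> real^'d^'d \<Rightarrow> bool" where
  "rows_spanned_by R A \<longleftrightarrow> (\<exists>\<alpha>. \<forall>j. j \<notin> R \<longrightarrow> (\<forall>k. A $ j $ k = (\<Sum>i\<in>R. \<alpha> j i * A $ i $ k)))"

lemma attention_map_in_range_param:
  assumes "rows_spanned_by R A" "V $ l0 $ i0 \<noteq> 0"
  shows "\<exists>\<theta>. attention_map A V = (attention_map (param_A R \<theta>) (param_V l0 i0 \<theta>) :: real^'t^'d \<Rightarrow> real^'t^'e)"
proof -
  obtain \<alpha> where \<alpha>: "\<And>j k. j \<notin> R \<Longrightarrow> A $ j $ k = (\<Sum>i\<in>R. \<alpha> j i * A $ i $ k)"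
    using assms(1) unfolding rows_spanned_by_def by blast
  let ?c = "V $ l0 $ i0"
  \<comment> \<open>Rows in \<open>R\<close> absorb the factor \<open>?c\<close>; the coefficients
    of the other rows are unchanged, since a common factor preserves linear relations between
    rows.\<close>
  define \<theta> where "\<theta> = case_sum (\<lambda>(j, k). if j \<in> R then ?c * A $ j $ k else \<alpha> j k)
    (\<lambda>(l, i). V $ l $ i / ?c)"
  have "attention_map (param_A R \<theta>) (param_V l0 i0 \<theta>) = (attention_map A V :: real^'t^'d \<Rightarrow> real^'t^'e)"
  proof (rule attention_map_scale[OF assms(2)])
    show "param_A R \<theta> $ m $ k = ?c * A $ m $ k" for m k
      using \<alpha>[of m k] by (simp add: param_A_def \<theta>_def sum_distrib_left mult_ac)
    show "param_V l0 i0 \<theta> $ l $ i = V $ l $ i / ?c" for l i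
      using assms(2) by (simp add: param_V_def \<theta>_def)
  qed
  then show ?thesis
    by metis
qed

text \<open>Only \<open>K\<close> moves, along a line to a matrix whose columns indexed by
  \<open>range \<iota>\<close> form the identity at \<open>s = 1\<close>. So the determinant of this
  block has finitely many zeros, and off them \<open>Q\<close>, hence every row of
  \<open>A s\<close>, is recovered from the rows of \<open>A s\<close> in
  \<open>range \<iota>\<close>.\<close>

lemma generic_rows_spanned_by_card_le:
  fixes Q K :: "real^'d^'a" and \<iota> :: "'a::finite \<Rightarrow> 'd::finite"
  assumes "inj \<iota>"
  shows "\<exists>A. (\<forall>m k. univariate_poly (\<lambda>s. A s $ m $ k)) \<and> A 0 = transpose K ** Q \<and>
    finite {s. \<not> rows_spanned_by (range \<iota>) (A s)}"
proof -
  define K' where "K' s = (\<chi> m j. K $ m $ j + s * ((if j = \<iota> m then 1 else 0) - K $ m $ j))" for s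
  define A where "A s = transpose (K' s) ** Q" for s
  define B where "B s = (\<chi> m m'. K' s $ m' $ \<iota> m)" for s :: real
  have K': "univariate_poly (\<lambda>s. K' s $ m $ j)" for m j
    unfolding K'_def by (simp add: univariate_poly_affine)
  have A_entry: "A s $ j $ k = (\<Sum>m\<in>UNIV. K' s $ m $ j * Q $ m $ k)" for s j k
    by (simp add: A_def matrix_matrix_mult_def transpose_def)
  have "K' 0 = K"
    by (simp add: K'_def vec_eq_iff)
  then have "A 0 = transpose K ** Q"
    by (simp add: A_def)
  moreover have "univariate_poly (\<lambda>s. A s $ m $ k)" for m k
    unfolding A_entry by (intro univariate_poly_sum univariate_poly_mult K' univariate_poly_const)
  moreover have "rows_spanned_by (range \<iota>) (A s)" if det: "det (B s) \<noteq> 0" for s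
  proof -
    obtain C where C: "C ** B s = mat 1"
      using det invertible_det_nz[of "B s"] unfolding invertible_def by blast
    have "B s ** Q = (\<chi> m k. A s $ \<iota> m $ k)"
      by (simp add: vec_eq_iff A_entry B_def matrix_matrix_mult_def)
    then have Q: "Q = C ** (\<chi> m k. A s $ \<iota> m $ k)"
      using C by (metis matrix_mul_assoc matrix_mul_lid)
    define \<alpha> where "\<alpha> j i = (\<Sum>m\<in>UNIV. K' s $ m $ j * C $ m $ inv \<iota> i)" for j i
    have "A s $ j $ k = (\<Sum>i\<in>range \<iota>. \<alpha> j i * A s $ i $ k)" for j k
    proof -
      have "A s $ j $ k = (\<Sum>m\<in>UNIV. K' s $ m $ j * (\<Sum>m'\<in>UNIV. C $ m $ m' * A s $ \<iota> m' $ k))"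
        by (subst A_entry, subst Q) (simp add: matrix_matrix_mult_def)
      also have "\<dots> = (\<Sum>m'\<in>UNIV. \<alpha> j (\<iota> m') * A s $ \<iota> m' $ k)"
        unfolding \<alpha>_def sum_distrib_left sum_distrib_right
        by (subst sum.swap) (simp add: assms mult.assoc)
      also have "\<dots> = (\<Sum>i\<in>range \<iota>. \<alpha> j i * A s $ i $ k)"
        by (simp add: sum.reindex[OF assms])
      finally show ?thesis .
    qed
    then show ?thesis
      unfolding rows_spanned_by_def by blast
  qed
  then have "{s. \<not> rows_spanned_by (range \<iota>) (A s)} \<subseteq> {s. det (B s) = 0}"
    by blast
  moreover have "finite {s. det (B s) = 0}"
  proof (rule univariate_poly_finite_zeros)
    show "univariate_poly (\<lambda>s. det (B s))"
      by (intro univariate_poly_det) (simp add: B_def K')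
    have "B 1 = mat 1"
      using assms by (auto simp: B_def K'_def mat_def vec_eq_iff inj_eq)
    then show "det (B 1) \<noteq> 0"
      by simp
  qed
  ultimately show ?thesis
    using finite_subset by blast
qed

text \<open>Moving \<open>A\<close> along the given path and the entry \<open>(l0, i0)\<close> of
  \<open>V\<close> along a line reaches the parametrized family for all but finitely many
  \<open>s\<close>. There \<open>p\<close> vanishes, so as a polynomial in \<open>s\<close> it also
  vanishes at \<open>s = 0\<close>.\<close>

lemma polynomial_vanishing_on_param:
  fixes p :: "(real^'t^'d \<Rightarrow> real^'t^'e) \<Rightarrow> real"
  assumes p: "polynomial_on Sym3 p"
    and vanish: "\<And>\<theta>. p (attention_map (param_A R \<theta>) (param_V l0 i0 \<theta>)) = 0"
    and A: "\<And>m k. univariate_poly (\<lambda>s. A s $ m $ k)" "finite {s. \<not> rows_spanned_by R (A s)}"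
  shows "p (attention_map (A 0) V) = 0"
proof (rule ccontr)
  define V' where "V' s = (\<chi> l i. V $ l $ i + s * (if (l, i) = (l0, i0) then 1 else 0))" for s
  have V'_0: "V' 0 = V"
    by (simp add: V'_def vec_eq_iff)
  assume "p (attention_map (A 0) V) \<noteq> 0"
  then have "finite {s. p (attention_map (A s) (V' s)) = 0}"
    by (intro univariate_poly_finite_zeros[where a = 0] univariate_poly_attention_map p A)
       (simp_all add: V'_0, simp add: V'_def univariate_poly_affine)
  moreover have "p (attention_map (A s) (V' s)) = 0"
    if s: "rows_spanned_by R (A s)" "s \<noteq> - V $ l0 $ i0" for s
  proof -
    have "V' s $ l0 $ i0 \<noteq> 0"
      using s(2) by (simp add: V'_def)
    then obtain \<theta> where
      "attention_map (A s) (V' s) = (attention_map (param_A R \<theta>) (param_V l0 i0 \<theta>) :: real^'t^'d \<Rightarrow> real^'t^'e)"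
      using attention_map_in_range_param[OF s(1)] by blast
    then show ?thesis
      by (simp add: vanish)
  qed
  then have "UNIV \<subseteq> {s. p (attention_map (A s) (V' s)) = 0} \<union>
      {s. \<not> rows_spanned_by R (A s)} \<union> {- V $ l0 $ i0}"
    by blast
  ultimately have "finite (UNIV :: real set)"
    using A(2) by (meson finite.emptyI finite_UnI finite_insert finite_subset)
  then show False
    using infinite_UNIV_char_0 by blast
qed

text \<open>Coefficients \<open>1\<close> rather than \<open>0\<close> outside \<open>R\<close> make every row of \<open>A\<close> nonzero at the base point,
  so that every entry of \<open>V\<close> stays visible in the cubic map.\<close>

definition base_point :: "'d set \<Rightarrow> 'd \<times> 'd + 'e \<times> 'd \<Rightarrow> real" where
  "base_point R = case_sum (\<lambda>(j, k). if j \<in> R then if j = k then 1 else 0 else 1) (\<lambda>_. 0)"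

text \<open>Low ranks are freed first. Coefficients of rows outside \<open>R\<close> are read off
  while the rows in \<open>R\<close> are still unit rows, and all entries of \<open>A\<close> while
  row \<open>l0\<close> of \<open>V\<close> is still a unit row.\<close>

definition param_rank :: "'d set \<Rightarrow> 'd \<times> 'd + 'e \<times> 'd \<Rightarrow> nat" where
  "param_rank R = case_sum (\<lambda>(j, k). if j \<in> R then 1 else 0) (\<lambda>_. 2)"

text \<open>The product \<open>V $ l $ i * A $ i $ k\<close> vanishes together with the entry of
  \<open>V\<close>, whatever the other parameters are; it remains to find a column where row
  \<open>i\<close> of \<open>A\<close> is nonzero at the base point.\<close>

lemma separating_polynomial_V:
  fixes R :: "'d::finite set" and l0 :: "'e::finite" and n0 n1 :: "'t::finite"
  assumes "n1 \<noteq> n0" "R \<noteq> {}" "(l, i) \<noteq> (l0, i0)"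
  shows "\<exists>p :: (real^'t^'d \<Rightarrow> real^'t^'e) \<Rightarrow> real. polynomial_on Sym3 p \<and>
    p (attention_map (param_A R ((base_point R)(Inr (l, i) := 1)))
         (param_V l0 i0 ((base_point R)(Inr (l, i) := 1)))) \<noteq> 0 \<and>
    (\<forall>\<theta>. \<theta> (Inr (l, i)) = 0 \<longrightarrow> p (attention_map (param_A R \<theta>) (param_V l0 i0 \<theta>)) = 0)"
proof -
  obtain r where r: "r \<in> R"
    using assms(2) by blast
  \<comment> \<open>For \<open>i\<close> outside \<open>R\<close>, row \<open>i\<close> is the sum
    of the unit rows in \<open>R\<close>, so any column \<open>r\<close> in \<open>R\<close> has
    entry 1.\<close>
  define k where "k = (if i \<in> R then i else r)"
  have "param_A R ((base_point R)(Inr (l, i) := 1)) $ i $ k = 1"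
  proof (cases "i \<in> R")
    case False
    have "(\<Sum>i'\<in>R. base_point R (Inl (i, i')) * base_point R (Inl (i', r)))
        = (\<Sum>i'\<in>R. if i' = r then 1 else 0)"
      using False by (intro sum.cong) (auto simp: base_point_def)
    then show ?thesis
      using False r by (simp add: param_A_def k_def)
  qed (simp add: param_A_def base_point_def k_def)
  then show ?thesis
    using assms(3)
    by (intro exI[of _ "token_interaction n1 n0 l (axis i 1) (axis k 1)"])
       (auto simp: polynomial_on_token_interaction token_interaction_axis[OF assms(1)] param_V_def)
qed

text \<open>Row \<open>l0\<close> of \<open>V\<close> is a unit row, which exposes the entry of
  \<open>A\<close>. For \<open>j\<close> outside \<open>R\<close>, column \<open>k\<close>
  restricted to the rows in \<open>R\<close> is a unit vector, so the sum defining that entry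
  collapses to one coefficient.\<close>

lemma attention_coordinate_param:
  fixes R :: "'d::finite set" and l0 :: "'e::finite" and n0 n1 :: "'t::finite"
  assumes "n1 \<noteq> n0" "j \<in> R \<or> k \<in> R"
    and "\<And>i. i \<noteq> i0 \<Longrightarrow> \<theta> (Inr (l0, i)) = 0"
    and "\<And>m. j \<notin> R \<Longrightarrow> m \<in> R \<Longrightarrow> \<theta> (Inl (m, k)) = (if m = k then 1 else 0)"
  shows "attention_coordinate n1 n0 l0 i0 j k
    (attention_map (param_A R \<theta>) (param_V l0 i0 \<theta>) :: real^'t^'d \<Rightarrow> real^'t^'e) = \<theta> (Inl (j, k))"
proof -
  have "attention_coordinate n1 n0 l0 i0 j k
      (attention_map (param_A R \<theta>) (param_V l0 i0 \<theta>) :: real^'t^'d \<Rightarrow> real^'t^'e) = param_A R \<theta> $ j $ k"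
    by (rule attention_coordinate_attention_map[OF assms(1)]) (simp add: param_V_def assms(3))
  also have "\<dots> = \<theta> (Inl (j, k))"
  proof (cases "j \<in> R")
    case False
    then have "(\<Sum>m\<in>R. \<theta> (Inl (j, m)) * \<theta> (Inl (m, k))) = (\<Sum>m\<in>R. if m = k then \<theta> (Inl (j, k)) else 0)"
      using assms(4) by (intro sum.cong) auto
    then show ?thesis
      using False assms(2) by (simp add: param_A_def)
  qed (simp add: param_A_def)
  finally show ?thesis .
qed

lemma zariski_dim_attention_parametrized:
  fixes R :: "'d::finite set" and M :: "(real^'t^'d \<Rightarrow> real^'t^'e) set" and l0 :: "'e::finite"
  assumes "CARD('t::finite) \<ge> 2" "R \<noteq> {}" "M \<subseteq> Sym3"
    and "\<And>\<theta>. attention_map (param_A R \<theta>) (param_V l0 i0 \<theta>) \<in> M"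
    and "\<And>p f. polynomial_on Sym3 p \<Longrightarrow>
      (\<And>\<theta>. p (attention_map (param_A R \<theta>) (param_V l0 i0 \<theta>)) = 0) \<Longrightarrow> f \<in> M \<Longrightarrow> p f = 0"
  shows "zariski_dim Sym3 M
    = enat (CARD('d)^2 - (CARD('d) - card R)^2 + (CARD('d) * CARD('e) - 1))"
proof -
  obtain n0 n1 :: 't where n: "n1 \<noteq> n0"
    using assms(1) by (metis card_2_iff' ex_card subset_UNIV)
  let ?I = "param_index R l0 i0" and ?b = "base_point R :: 'd \<times> 'd + 'e \<times> 'd \<Rightarrow> real"
  let ?\<Psi> = "\<lambda>\<theta>. attention_map (param_A R \<theta>) (param_V l0 i0 \<theta>) :: real^'t^'d \<Rightarrow> real^'t^'e"
  let ?rk = "param_rank R :: 'd \<times> 'd + 'e \<times> 'd \<Rightarrow> nat"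
  have sep: "\<exists>p. polynomial_on Sym3 p \<and> p (?\<Psi> (?b(x := ?b x + 1))) \<noteq> 0 \<and>
      (\<forall>\<theta>. \<theta> x = ?b x \<longrightarrow> (\<forall>y\<in>?I. ?rk x < ?rk y \<longrightarrow> \<theta> y = ?b y) \<longrightarrow> p (?\<Psi> \<theta>) = 0)"
    if "x \<in> ?I" for x
  proof (cases x)
    case (Inr li)
    obtain l i where "li = (l, i)"
      by (cases li)
    with Inr that have x: "x = Inr (l, i)" "(l, i) \<noteq> (l0, i0)"
      by (auto simp: param_index_def)
    have "?b x = 0"
      by (simp add: x(1) base_point_def)
    then show ?thesis
      using separating_polynomial_V[OF n assms(2) x(2)] unfolding x(1) by auto
  next
    case (Inl jk)
    obtain j k where "jk = (j, k)"
      by (cases jk)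
    with Inl that have x: "x = Inl (j, k)" "j \<in> R \<or> k \<in> R"
      by (auto simp: param_index_def)
    \<comment> \<open>On the relevant maps this is \<open>\<theta> x - ?b x\<close>: zero while
      \<open>x\<close> is fixed and 1 after the shift.\<close>
    let ?p = "\<lambda>f. attention_coordinate n1 n0 l0 i0 j k f + - ?b x"
    have p: "?p (?\<Psi> \<theta>) = \<theta> x - ?b x" if \<theta>: "\<forall>y\<in>?I. ?rk x < ?rk y \<longrightarrow> \<theta> y = ?b y" for \<theta>
    proof -
      have "\<theta> (Inr (l0, i)) = 0" if "i \<noteq> i0" for i
        using \<theta>[rule_format, of "Inr (l0, i)"] that x
        by (auto simp: param_index_def param_rank_def base_point_def)
      moreover have "\<theta> (Inl (m, k)) = (if m = k then 1 else 0)" if "j \<notin> R" "m \<in> R" for m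
        using \<theta>[rule_format, of "Inl (m, k)"] that x
        by (auto simp: param_index_def param_rank_def base_point_def)
      ultimately have "attention_coordinate n1 n0 l0 i0 j k (?\<Psi> \<theta>) = \<theta> (Inl (j, k))"
        by (rule attention_coordinate_param[OF n x(2)])
      then show ?thesis
        using x(1) by simp
    qed
    have "polynomial_on Sym3 ?p"
      by (intro polynomial_on.add polynomial_on.const polynomial_on_attention_coordinate)
    moreover have "?p (?\<Psi> (?b(x := ?b x + 1))) \<noteq> 0"
      by (subst p) auto
    moreover have "?p (?\<Psi> \<theta>) = 0" if "\<theta> x = ?b x" "\<forall>y\<in>?I. ?rk x < ?rk y \<longrightarrow> \<theta> y = ?b y" for \<theta>
      using p[OF that(2)] that(1) by simp
    ultimately show ?thesis
      by blast
  qed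
  have "zariski_dim Sym3 M = enat (card ?I)"
  proof (rule zariski_dim_parametrized[where \<Psi> = ?\<Psi> and b = ?b and rk = ?rk])
    show "\<forall>L. linear_functional_on Sym3 L \<longrightarrow> (\<exists>n. poly_fun ?I n (\<lambda>\<theta>. L (?\<Psi> \<theta>)))"
      using poly_fun_attention_map_param by blast
  qed (use assms(3,4) sep in simp_all, use assms(5) in blast)
  then show ?thesis
    by (simp add: card_param_index)
qed

section \<open>Realization by queries and keys\<close>

lemma param_in_neuromanifold_card_le:
  fixes \<iota> :: "'a::finite \<Rightarrow> 'd::finite"
  assumes "inj \<iota>"
  shows "attention_map (param_A (range \<iota>) \<theta>) V \<in> (neuromanifold TYPE('a) :: (real^'t^'d \<Rightarrow> real^'t^'e) set)"
proof -
  define Q :: "real^'d^'a" where "Q = (\<chi> m k. \<theta> (Inl (\<iota> m, k)))"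
  \<comment> \<open>The identity block copies the rows of \<open>Q\<close> into the rows in
    \<open>range \<iota>\<close>; the other columns of \<open>K\<close> hold the combination
    coefficients.\<close>
  define K :: "real^'d^'a" where
    "K = (\<chi> m j. if j \<in> range \<iota> then if j = \<iota> m then 1 else 0 else \<theta> (Inl (j, \<iota> m)))"
  have "(transpose K ** Q) $ j $ k = param_A (range \<iota>) \<theta> $ j $ k" for j k
  proof (cases "j \<in> range \<iota>")
    case True
    then obtain m where m: "j = \<iota> m"
      by blast
    have "(transpose K ** Q) $ j $ k = (\<Sum>m'\<in>UNIV. K $ m' $ j * Q $ m' $ k)"
      by (simp add: matrix_matrix_mult_def transpose_def)
    also have "\<dots> = (\<Sum>m'\<in>UNIV. if m' = m then \<theta> (Inl (j, k)) else 0)"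
      using assms by (intro sum.cong) (auto simp: K_def Q_def m inj_eq)
    finally show ?thesis
      using True by (simp add: param_A_def)
  next
    case False
    then have "(transpose K ** Q) $ j $ k = (\<Sum>m\<in>UNIV. \<theta> (Inl (j, \<iota> m)) * \<theta> (Inl (\<iota> m, k)))"
      by (simp add: matrix_matrix_mult_def transpose_def K_def Q_def)
    then show ?thesis
      using False by (simp add: param_A_def sum.reindex[OF assms])
  qed
  then have "param_A (range \<iota>) \<theta> = transpose K ** Q"
    by (simp add: vec_eq_iff)
  then have "attention_map (param_A (range \<iota>) \<theta>) V = (lightning_attention Q K V :: real^'t^'d \<Rightarrow> real^'t^'e)"
    by (simp add: lightning_attention_eq)
  then show ?thesis
    unfolding neuromanifold_def by blast
qed

text \<open>Row \<open>j\<close> of \<open>A\<close> is stored as row \<open>\<kappa> j\<close> of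
  \<open>Q\<close>, and \<open>K\<close> selects it again. By injectivity the sum defining
  \<open>Q\<close> has at most one nonzero term, and rows outside the range are zero.\<close>

lemma attention_map_in_neuromanifold_card_ge:
  fixes \<kappa> :: "'d::finite \<Rightarrow> 'a::finite"
  assumes "inj \<kappa>"
  shows "attention_map A V \<in> (neuromanifold TYPE('a) :: (real^'t^'d \<Rightarrow> real^'t^'e) set)"
proof -
  define Q :: "real^'d^'a" where "Q = (\<chi> m k. \<Sum>j\<in>UNIV. if m = \<kappa> j then A $ j $ k else 0)"
  define K :: "real^'d^'a" where "K = (\<chi> m j. if m = \<kappa> j then 1 else 0)"
  have "(transpose K ** Q) $ j $ k = A $ j $ k" for j k
  proof -
    have "(transpose K ** Q) $ j $ k = (\<Sum>m\<in>UNIV. K $ m $ j * Q $ m $ k)"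
      by (simp add: matrix_matrix_mult_def transpose_def)
    also have "\<dots> = (\<Sum>m\<in>UNIV. if m = \<kappa> j then Q $ m $ k else 0)"
      by (intro sum.cong) (auto simp: K_def)
    also have "\<dots> = A $ j $ k"
      using assms by (simp add: Q_def inj_eq)
    finally show ?thesis .
  qed
  then have "A = transpose K ** Q"
    by (simp add: vec_eq_iff)
  then have "attention_map A V = (lightning_attention Q K V :: real^'t^'d \<Rightarrow> real^'t^'e)"
    by (simp add: lightning_attention_eq)
  then show ?thesis
    unfolding neuromanifold_def by blast
qed

theorem corollary3p3:
  assumes "CARD('t::finite) \<ge> 2"
    and "(CARD('d::finite) \<ge> 2 \<and> CARD('e::finite) \<ge> 2) \<or> (CARD('d) \<ge> 2 \<and> CARD('a::finite) \<ge> 2)"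
  shows "zariski_dim Sym3 (neuromanifold TYPE('a) :: (real^'t^'d \<Rightarrow> real^'t^'e) set) =
    enat (if CARD('a) \<le> CARD('d)
          then 2 * CARD('a) * CARD('d) + CARD('d) * CARD('e) - CARD('a)^2 - 1
          else CARD('d)^2 + CARD('d) * CARD('e) - 1)"
proof -
  let ?M = "neuromanifold TYPE('a) :: (real^'t^'d \<Rightarrow> real^'t^'e) set"
  fix l0 :: 'e and i0 :: 'd
  have pos: "1 \<le> CARD('d) * CARD('e)"
    by (simp add: Suc_leI)
  show ?thesis
  proof (cases "CARD('a) \<le> CARD('d)")
    case True
    then obtain \<iota> :: "'a \<Rightarrow> 'd" where \<iota>: "inj \<iota>"
      using card_le_inj[of "UNIV :: 'a set" "UNIV :: 'd set"] by auto
    have "p f = 0" if p: "polynomial_on Sym3 p"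
      and vanish: "\<And>\<theta>. p (attention_map (param_A (range \<iota>) \<theta>) (param_V l0 i0 \<theta>)) = 0"
      and f: "f \<in> ?M" for p f
    proof -
      obtain Q K :: "real^'d^'a" and V where f_eq: "f = attention_map (transpose K ** Q) V"
        using f unfolding neuromanifold_def lightning_attention_eq by blast
      obtain A where A: "\<And>m k. univariate_poly (\<lambda>s. A s $ m $ k)" "A 0 = transpose K ** Q"
        "finite {s. \<not> rows_spanned_by (range \<iota>) (A s)}"
        using generic_rows_spanned_by_card_le[OF \<iota>] by metis
      show ?thesis
        using polynomial_vanishing_on_param[OF p vanish A(1,3)] by (simp add: f_eq A(2))
    qed
    then have "zariski_dim Sym3 ?M
        = enat (CARD('d)^2 - (CARD('d) - card (range \<iota>))^2 + (CARD('d) * CARD('e) - 1))"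
      by (intro zariski_dim_attention_parametrized[OF assms(1), where ?l0.0 = l0 and ?i0.0 = i0]
          param_in_neuromanifold_card_le[OF \<iota>] neuromanifold_subset_Sym3) auto
    moreover have "card (range \<iota>) = CARD('a)"
      using \<iota> by (rule card_image)
    moreover have "CARD('d)^2 - (CARD('d) - CARD('a))^2 + (CARD('d) * CARD('e) - 1)
        = 2 * CARD('a) * CARD('d) + CARD('d) * CARD('e) - CARD('a)^2 - 1"
    proof -
      \<comment> \<open>Writing \<open>d = a + x\<close> turns the truncated subtraction into exact
        arithmetic.\<close>
      obtain x where "CARD('d) = CARD('a) + x"
        using True le_iff_add by blast
      then have "CARD('d)^2 - (CARD('d) - CARD('a))^2 + CARD('a)^2 = 2 * CARD('a) * CARD('d)"
        by (simp add: power2_eq_square algebra_simps)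
      then show ?thesis
        using pos by linarith
    qed
    ultimately show ?thesis
      using True by simp
  next
    case False
    then obtain \<kappa> :: "'d \<Rightarrow> 'a" where \<kappa>: "inj \<kappa>"
      using card_le_inj[of "UNIV :: 'd set" "UNIV :: 'a set"] by auto
    have "p f = 0" if p: "polynomial_on Sym3 p"
      and vanish: "\<And>\<theta>. p (attention_map (param_A UNIV \<theta>) (param_V l0 i0 \<theta>)) = 0"
      and f: "f \<in> ?M" for p f
    proof -
      obtain A V where "f = attention_map A V"
        using f unfolding neuromanifold_def lightning_attention_eq by blast
      then show ?thesis
        \<comment> \<open>With all rows in \<open>R\<close> the spanning condition is vacuous, so a
          constant path for \<open>A\<close> suffices and only \<open>V\<close> is
          perturbed.\<close>
        using polynomial_vanishing_on_param[OF p vanish, where A = "\<lambda>_. A"]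
        by (simp add: univariate_poly_const rows_spanned_by_def)
    qed
    then have "zariski_dim Sym3 ?M
        = enat (CARD('d)^2 - (CARD('d) - CARD('d))^2 + (CARD('d) * CARD('e) - 1))"
      by (intro zariski_dim_attention_parametrized[OF assms(1), where ?l0.0 = l0 and ?i0.0 = i0]
          attention_map_in_neuromanifold_card_ge[OF \<kappa>] neuromanifold_subset_Sym3) auto
    then show ?thesis
      using False pos by simp
  qed
qed

end
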